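(* Let $F$ be a ribbon graph, let $\alpha\neq -2,0,1$, $\beta=\alpha(1-\alpha)$ and $\gamma=1/\sqrt{\alpha\beta}$. Then \[ R(F\otimes C_3;\alpha,\beta,\gamma)=(\alpha+2)^{n(F)}\,R\!\left(F;\,\alpha(\alpha+2),\,\frac{\beta}{\alpha+2},\,\gamma\right). \]
   Context: A ribbon graph is a graph with a fixed cyclic order of half-edges at each vertex, regarded as an orientable surface with boundary (vertex discs joined by untwisted edge bands). $v,e,k$ denote numbers of vertices, edges, connected components; $r(H)=v(H)-k(H)$, $n(H)=e(H)-r(H)$; $p(H)$ is the number of boundary components of $H$ as a surface. A state is a spanning sub-ribbon graph (all vertices, a subset of edges); ${\mathcal S}(F)$ is the set of states. Bollobás–Riordan polynomial: $R(F;\alpha,\beta,\gamma)=\sum_{H\in{\mathcal S}(F)}\alpha^{r(F)-r(H)}\beta^{n(H)}\gamma^{k(H)-p(H)+n(H)}$. Tensor product with a cycle: $F\otimes C_p$ is obtained by identifying each edge of $F$ with a distinguished edge of its own copy of the $p$-cycle $C_p$ and then deleting the original edges (a 2-sum with $C_p$ at every edge); equivalently each edge of $F$ is replaced, within its band, by a path of $p-1$ edges through $p-2$ new degree-two vertices. In particular $F\otimes C_3$ is obtained by subdividing every edge of $F$ once. *)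

theory Defs
  imports Complex_Main "HOL-Combinatorics.Orbits"
begin

text \<open>
  Ribbon graphs are encoded by their half-edges (darts): \<open>vert d\<close> is the vertex carrying the
  half-edge \<open>d\<close>, \<open>opp d\<close> is the other half of the edge of \<open>d\<close>, and \<open>rot d\<close> is the successor of
  \<open>d\<close> in the cyclic order at \<open>vert d\<close>. The vertex set is kept separately, since vertices without
  half-edges must be allowed. Loops and multiple edges are allowed.
\<close>

record ('v, 'd) pre_ribbon_graph =
  verts :: "'v set"
  darts :: "'d set"
  vert :: "'d \<Rightarrow> 'v"
  opp :: "'d \<Rightarrow> 'd"
  rot :: "'d \<Rightarrow> 'd"

definition darts_at :: "('v, 'd) pre_ribbon_graph \<Rightarrow> 'v \<Rightarrow> 'd set" where
  "darts_at F v = {d \<in> darts F. vert F d = v}"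

locale ribbon_graph =
  fixes F :: "('v, 'd) pre_ribbon_graph"
  assumes finite_verts: "finite (verts F)"
    and finite_darts: "finite (darts F)"
    and vert_in_verts: "d \<in> darts F \<Longrightarrow> vert F d \<in> verts F"
    and opp_in_darts: "d \<in> darts F \<Longrightarrow> opp F d \<in> darts F"
    and opp_neq: "d \<in> darts F \<Longrightarrow> opp F d \<noteq> d"
    and opp_opp: "d \<in> darts F \<Longrightarrow> opp F (opp F d) = d"
    and rot_cyclic: "v \<in> verts F \<Longrightarrow> darts_at F v \<noteq> {} \<Longrightarrow> cyclic_on (rot F) (darts_at F v)"

definition edges :: "('v, 'd) pre_ribbon_graph \<Rightarrow> 'd set set" where
  "edges F = (\<lambda>d. {d, opp F d}) ` darts F"

definition adjacency :: "('v, 'd) pre_ribbon_graph \<Rightarrow> 'v rel" where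
  "adjacency F = (\<lambda>d. (vert F d, vert F (opp F d))) ` darts F"

definition components :: "('v, 'd) pre_ribbon_graph \<Rightarrow> 'v set set" where
  "components F = verts F // (adjacency F)\<^sup>*"

definition num_v :: "('v, 'd) pre_ribbon_graph \<Rightarrow> int" where
  "num_v F = int (card (verts F))"

definition num_e :: "('v, 'd) pre_ribbon_graph \<Rightarrow> int" where
  "num_e F = int (card (edges F))"

definition num_k :: "('v, 'd) pre_ribbon_graph \<Rightarrow> int" where
  "num_k F = int (card (components F))"

definition rk :: "('v, 'd) pre_ribbon_graph \<Rightarrow> int" where
  "rk F = num_v F - num_k F"

definition nul :: "('v, 'd) pre_ribbon_graph \<Rightarrow> int" where
  "nul F = num_e F - rk F"

text \<open>
  Since the bands are untwisted, a boundary component of the surface that meets some band follows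
  the side of a band from \<open>d\<close> to \<open>opp d\<close> and then the arc of the vertex disc from \<open>opp d\<close> to the next
  half-edge \<open>rot (opp d)\<close>; these components are the orbits of \<open>rot \<circ> opp\<close>, each band side being
  traversed once. Every other boundary component is the boundary circle of the disc of a vertex
  without half-edges.
\<close>

definition boundary_walks :: "('v, 'd) pre_ribbon_graph \<Rightarrow> 'd set set" where
  "boundary_walks F = orbit (rot F \<circ> opp F) ` darts F"

definition isolated_verts :: "('v, 'd) pre_ribbon_graph \<Rightarrow> 'v set" where
  "isolated_verts F = {v \<in> verts F. darts_at F v = {}}"

definition num_p :: "('v, 'd) pre_ribbon_graph \<Rightarrow> int" where
  "num_p F = int (card (boundary_walks F)) + int (card (isolated_verts F))"

text \<open>
  The cyclic order induced on a set \<open>B\<close> of half-edges: the successor of \<open>d\<close> is the first element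
  of \<open>B\<close> met when iterating \<open>rot\<close> from \<open>d\<close>.
\<close>

definition induced_rot :: "('d \<Rightarrow> 'd) \<Rightarrow> 'd set \<Rightarrow> 'd \<Rightarrow> 'd" where
  "induced_rot f B d = (f ^^ (LEAST n. 0 < n \<and> (f ^^ n) d \<in> B)) d"

definition spanning_sub ::
    "('v, 'd) pre_ribbon_graph \<Rightarrow> 'd set set \<Rightarrow> ('v, 'd) pre_ribbon_graph" where
  "spanning_sub F A = F\<lparr>darts := \<Union>A, rot := induced_rot (rot F) (\<Union>A)\<rparr>"

definition states :: "('v, 'd) pre_ribbon_graph \<Rightarrow> ('v, 'd) pre_ribbon_graph set" where
  "states F = {spanning_sub F A | A. A \<subseteq> edges F}"

text \<open>
  The three exponents are non-negative integers for every state of a ribbon graph (the last one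
  is twice the genus), so the integer powers below are ordinary powers.
\<close>

definition BR_poly :: "('v, 'd) pre_ribbon_graph \<Rightarrow> 'a::field \<Rightarrow> 'a \<Rightarrow> 'a \<Rightarrow> 'a" where
  "BR_poly F \<alpha> \<beta> \<gamma> =
     (\<Sum>H\<in>states F. \<alpha> powi (rk F - rk H) * \<beta> powi nul H * \<gamma> powi (num_k H - num_p H + nul H))"

text \<open>
  The tensor product with the \<open>p\<close>-cycle (\<open>p \<ge> 2\<close>): the edge \<open>{d, opp d}\<close> is replaced by a path of
  \<open>p - 1\<close> edges from \<open>vert d\<close> to \<open>vert (opp d)\<close>. With the vertices of this path numbered
  \<open>0, \<dots>, p - 1\<close> starting from \<open>vert d\<close>, the half-edge \<open>(d, i)\<close>, \<open>i < p - 1\<close>, is the one at vertex \<open>i\<close>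
  that points towards vertex \<open>i + 1\<close>. Numbering the path from the other end turns vertex \<open>i\<close> into
  vertex \<open>p - 1 - i\<close>, so the other half of this edge is \<open>(opp d, p - 2 - i)\<close>, and for \<open>i \<ge> 1\<close> the
  other half-edge at vertex \<open>i\<close> is \<open>(opp d, p - 1 - i)\<close>. A new vertex is encoded as the set of its
  two half-edges. The half-edge \<open>(d, 0)\<close> takes the place of \<open>d\<close> in the cyclic order at \<open>vert d\<close>.
\<close>

definition path_vert :: "('v, 'd) pre_ribbon_graph \<Rightarrow> nat \<Rightarrow> 'd \<times> nat \<Rightarrow> ('d \<times> nat) set" where
  "path_vert F p = (\<lambda>(d, i). {(d, i), (opp F d, p - 1 - i)})"

definition tensor_cycle ::
    "('v, 'd) pre_ribbon_graph \<Rightarrow> nat \<Rightarrow> ('v + ('d \<times> nat) set, 'd \<times> nat) pre_ribbon_graph" where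
  "tensor_cycle F p =
     \<lparr>verts = Inl ` verts F \<union> Inr ` path_vert F p ` (darts F \<times> {1..<p - 1}),
      darts = darts F \<times> {..<p - 1},
      vert = (\<lambda>(d, i). if i = 0 then Inl (vert F d) else Inr (path_vert F p (d, i))),
      opp = (\<lambda>(d, i). (opp F d, p - 2 - i)),
      rot = (\<lambda>(d, i). if i = 0 then (rot F d, 0) else (opp F d, p - 1 - i))\<rparr>"

end

theory Submission
  imports Defs
begin

text \<open>
  The argument works for every cycle length \<open>p\<close>, with \<open>\<sigma> = ((1 + \<alpha>) ^ (p - 1) - 1) / \<alpha>\<close> in
  place of \<open>\<alpha> + 2\<close>. A state of the tensor product keeps some edges of each of the paths that
  replace the edges of \<open>F\<close>; let \<open>A\<close> consist of the edges of \<open>F\<close> whose path is kept as a whole.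
  If a path is kept only in part, then one of its kept edges is pendant. Deleting a pendant edge
  detaches one vertex, so the numbers of components and of boundary components both grow by one.
  Hence the partly kept paths can be deleted without affecting the nullity or the genus exponent,
  and what remains is the state \<open>A\<close> of \<open>F\<close> with its edges subdivided and some isolated vertices
  added. So the term of a state above \<open>A\<close> is the term of \<open>A\<close> times a power of \<open>\<alpha>\<close> that depends
  on the numbers of edges kept in the paths outside \<open>A\<close>. Summing over these states gives \<open>\<sigma>\<close> to
  the power \<open>e(F) - e(A) = n(F) + (r(F) - r(A)) - n(A)\<close>, and these three summands are absorbed by
  the prefactor and the new arguments.

  Boundary components are easier to compare if no half-edges are deleted: let the boundary walk of
  a state turn around each vertex of \<open>F\<close>, ignoring the bands that are not kept. Its orbits on all
  half-edges count the boundary components, and deleting an edge changes this walk by a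
  transposition.
\<close>

subsection \<open>Classes and sums over set families\<close>

lemma card_classes_merge:
  fixes c c' :: "'a \<Rightarrow> 'a set"
  assumes "finite X" and xy: "x \<in> X" "y \<in> X" "c x \<noteq> c y"
    and self: "\<And>u. u \<in> X \<Longrightarrow> u \<in> c u"
    and class_eq: "\<And>u v. u \<in> X \<Longrightarrow> v \<in> c u \<Longrightarrow> c v = c u"
    and merged: "\<And>u. u \<in> X \<Longrightarrow> c' u = (if u \<in> c x \<union> c y then c x \<union> c y else c u)"
  shows "card (c ` X) = Suc (card (c' ` X))"
proof -
  have mem_iff: "u \<in> c v \<longleftrightarrow> c u = c v" if "u \<in> X" "v \<in> X" for u v
    using that self[of u] class_eq[of v u] by auto
  have "c x = c u \<and> c y = c u" if "u \<in> X" "c u = c x \<union> c y" for u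
    using that mem_iff xy self[of x] self[of y] by blast
  then have "c x \<union> c y \<notin> c ` X - {c x, c y}"
    using xy(3) by force
  moreover have "c' ` X = insert (c x \<union> c y) (c ` X - {c x, c y})"
  proof
    show "c' ` X \<subseteq> insert (c x \<union> c y) (c ` X - {c x, c y})"
      using merged mem_iff xy by auto
    have "c x \<union> c y \<in> c' ` X"
      using merged[OF xy(1)] self xy(1) by auto
    moreover have "c u \<in> c' ` X" if "u \<in> X" "c u \<notin> {c x, c y}" for u
      using merged[OF that(1)] mem_iff[OF that(1)] xy that by auto
    ultimately show "insert (c x \<union> c y) (c ` X - {c x, c y}) \<subseteq> c' ` X" by blast
  qed
  ultimately have "card (c' ` X) = Suc (card (c ` X - {c x, c y}))"
    using \<open>finite X\<close> by simp
  also have "\<dots> = Suc (card (c ` X) - 2)"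
    using xy by (simp add: card_Diff_subset)
  finally have "card (c' ` X) = Suc (card (c ` X) - 2)" .
  moreover have "card {c x, c y} \<le> card (c ` X)"
    using xy \<open>finite X\<close> by (intro card_mono) auto
  ultimately show ?thesis
    using xy(3) by simp
qed

lemma equiv_rtrancl: "sym r \<Longrightarrow> equiv UNIV (r\<^sup>*)"
  by (simp add: equiv_def refl_rtrancl sym_rtrancl trans_rtrancl)

lemma rtrancl_insert_edge_Image:
  fixes r :: "'a rel" and x y :: 'a
  assumes "sym r"
  defines "r' \<equiv> r \<union> {(x, y), (y, x)}"
  shows "r'\<^sup>* `` {u} =
    (if u \<in> r\<^sup>* `` {x} \<union> r\<^sup>* `` {y} then r\<^sup>* `` {x} \<union> r\<^sup>* `` {y} else r\<^sup>* `` {u})"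
proof -
  define C where "C = r\<^sup>* `` {x} \<union> r\<^sup>* `` {y}"
  have equiv: "equiv UNIV (r\<^sup>*)" "equiv UNIV (r'\<^sup>*)"
    using \<open>sym r\<close> unfolding r'_def by (auto intro!: equiv_rtrancl simp: sym_def)
  have mono: "r\<^sup>* \<subseteq> r'\<^sup>*"
    by (intro rtrancl_mono) (auto simp: r'_def)
  have "C \<subseteq> r'\<^sup>* `` {x}"
    using mono r_into_rtrancl[of "(x, y)" r'] by (auto simp: C_def r'_def intro: rtrancl_trans)
  have closed: "w \<in> C" if "(u, w) \<in> r'\<^sup>*" "u \<in> C" for w
    using that by induction (auto simp: C_def r'_def intro: rtrancl_into_rtrancl)
  have old: "(u, w) \<in> r\<^sup>*" if "(u, w) \<in> r'\<^sup>*" "u \<notin> C" for w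
    using that(1)
  proof induction
    case (step v w)
    then have "v \<notin> C"
      using \<open>u \<notin> C\<close> equiv(1) by (auto simp: C_def equiv_class_eq_iff)
    then have "(v, w) \<in> r"
      using step.hyps(2) by (auto simp: r'_def C_def)
    with step.IH show ?case by simp
  qed simp
  have "r'\<^sup>* `` {u} = (if u \<in> C then C else r\<^sup>* `` {u})"
  proof (cases "u \<in> C")
    case True
    with \<open>C \<subseteq> r'\<^sup>* `` {x}\<close> have "r'\<^sup>* `` {u} = r'\<^sup>* `` {x}"
      using equiv(2) by (auto simp: equiv_class_eq_iff)
    with True closed \<open>C \<subseteq> r'\<^sup>* `` {x}\<close> show ?thesis by auto
  next
    case False
    with old mono show ?thesis by auto
  qed
  then show ?thesis
    by (simp only: C_def)
qed

lemma card_quotient_insert_edge: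
  assumes "finite V" and xy: "x \<in> V" "y \<in> V" "(x, y) \<notin> r\<^sup>*" and "sym r"
  shows "card (V // r\<^sup>*) = Suc (card (V // (r \<union> {(x, y), (y, x)})\<^sup>*))"
proof -
  have equiv: "equiv UNIV (r\<^sup>*)"
    using \<open>sym r\<close> by (rule equiv_rtrancl)
  have "card ((\<lambda>u. r\<^sup>* `` {u}) ` V) =
      Suc (card ((\<lambda>u. (r \<union> {(x, y), (y, x)})\<^sup>* `` {u}) ` V))"
  proof (rule card_classes_merge)
    show "r\<^sup>* `` {x} \<noteq> r\<^sup>* `` {y}"
      using xy(3) equiv by (simp add: equiv_class_eq_iff)
    show "r\<^sup>* `` {v} = r\<^sup>* `` {u}" if "v \<in> r\<^sup>* `` {u}" for u v
      using that equiv by (simp add: equiv_class_eq_iff)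
    show "(r \<union> {(x, y), (y, x)})\<^sup>* `` {u} =
        (if u \<in> r\<^sup>* `` {x} \<union> r\<^sup>* `` {y} then r\<^sup>* `` {x} \<union> r\<^sup>* `` {y} else r\<^sup>* `` {u})" for u
      using \<open>sym r\<close> by (rule rtrancl_insert_edge_Image)
  qed (use \<open>finite V\<close> xy in simp_all)
  then show ?thesis
    by (simp add: quotient_def UNION_singleton_eq_range)
qed

lemma sum_prod_Int_disjoint_family:
  fixes g :: "'i \<Rightarrow> 'a set \<Rightarrow> 'b::comm_semiring_1"
  assumes "finite I" and disj: "disjoint_family_on B I"
    and fin: "\<And>i. i \<in> I \<Longrightarrow> finite (B i)" and sub: "\<And>i. i \<in> I \<Longrightarrow> \<Y> i \<subseteq> Pow (B i)"
  shows "(\<Sum>S | S \<subseteq> \<Union>(B ` I) \<and> (\<forall>i\<in>I. S \<inter> B i \<in> \<Y> i). \<Prod>i\<in>I. g i (S \<inter> B i))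
    = (\<Prod>i\<in>I. \<Sum>Y\<in>\<Y> i. g i Y)"
proof -
  have trace: "\<Union>(h ` I) \<inter> B i = h i" if "h \<in> PiE I \<Y>" "i \<in> I" for h i
  proof
    show "h i \<subseteq> \<Union>(h ` I) \<inter> B i"
      using that sub by (auto simp: PiE_iff)
    show "\<Union>(h ` I) \<inter> B i \<subseteq> h i"
    proof
      fix s assume "s \<in> \<Union>(h ` I) \<inter> B i"
      then obtain j where "j \<in> I" "s \<in> h j" "s \<in> B i" by blast
      moreover from this have "s \<in> B j"
        using that sub by (auto simp: PiE_iff)
      ultimately show "s \<in> h i"
        using disjoint_family_onD[OF disj, of i j] \<open>i \<in> I\<close> by auto
    qed
  qed
  have "(\<Sum>S | S \<subseteq> \<Union>(B ` I) \<and> (\<forall>i\<in>I. S \<inter> B i \<in> \<Y> i). \<Prod>i\<in>I. g i (S \<inter> B i))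
      = (\<Sum>h\<in>PiE I \<Y>. \<Prod>i\<in>I. g i (h i))"
  proof (rule sum.reindex_bij_witness[where j = "\<lambda>S. \<lambda>i\<in>I. S \<inter> B i" and i = "\<lambda>h. \<Union>(h ` I)"])
    fix h assume "h \<in> PiE I \<Y>"
    then show "(\<lambda>i\<in>I. \<Union>(h ` I) \<inter> B i) = h"
      using trace by (intro extensionalityI[of _ I]) (auto simp: PiE_iff)
    show "\<Union>(h ` I) \<in> {S. S \<subseteq> \<Union>(B ` I) \<and> (\<forall>i\<in>I. S \<inter> B i \<in> \<Y> i)}"
      using \<open>h \<in> PiE I \<Y>\<close> trace sub by (fastforce simp: PiE_iff)
  qed auto
  also have "\<dots> = (\<Prod>i\<in>I. \<Sum>Y\<in>\<Y> i. g i Y)"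
    using \<open>finite I\<close> fin sub by (intro prod_sum_PiE[symmetric]) (auto intro: finite_subset)
  finally show ?thesis .
qed

lemma sum_psubset_power:
  fixes a :: "'a::field"
  assumes card: "card P = Suc m" and "a \<noteq> 0"
  shows "(\<Sum>Y | Y \<subset> P. a ^ (m - card Y)) = (\<Sum>i\<le>m. (1 + a) ^ i)"
proof -
  have "finite P"
    using card by (simp add: card_ge_0_finite)
  have exponent: "card (P - Y) = Suc (m - card Y)" if "Y \<subset> P" for Y
  proof -
    have "card Y \<le> m"
      using psubset_card_mono[OF \<open>finite P\<close> that] card by simp
    then show ?thesis
      using psubset_imp_subset[OF that] card \<open>finite P\<close>
      by (simp add: card_Diff_subset finite_subset Suc_diff_le)
  qed
  have psubsets: "{Y. Y \<subset> P} = Pow P - {P}" by blast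
  have "a * (\<Sum>Y | Y \<subset> P. a ^ (m - card Y)) = (\<Sum>Y | Y \<subset> P. a ^ card (P - Y))"
    by (simp add: sum_distrib_left exponent)
  also have "\<dots> = (\<Sum>Y\<in>Pow P. a ^ card (P - Y)) - 1"
    using \<open>finite P\<close> by (simp add: psubsets sum_diff1)
  also have "\<dots> = (1 + a) ^ Suc m - 1"
    using prod_add[OF \<open>finite P\<close>, of "\<lambda>_. 1" "\<lambda>_. a"] by (simp add: card)
  also have "\<dots> = a * (\<Sum>i\<le>m. (1 + a) ^ i)"
    by (simp only: power_diff_1_eq lessThan_Suc_atMost add_diff_cancel_left')
  finally show ?thesis
    using \<open>a \<noteq> 0\<close> by simp
qed

subsection \<open>Orbits and first returns\<close>

lemma orbit_involution:
  assumes "f (f x) = x"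
  shows "orbit f x = {x, f x}"
proof -
  have "orbit f x = (\<lambda>n. (f ^^ n) x) ` {..<2}"
    using assms by (subst orbit_altdef_bounded[of 2]) (auto simp: numeral_2_eq_2)
  then show ?thesis
    by (simp add: numeral_2_eq_2 lessThan_Suc insert_commute)
qed

lemma orbit_subset_closed:
  assumes "\<And>x. x \<in> X \<Longrightarrow> f x \<in> X" and "x \<in> X"
  shows "orbit f x \<subseteq> X"
proof
  fix y assume "y \<in> orbit f x"
  then show "y \<in> X"
    by induction (use assms in auto)
qed

lemma bij_betw_self_in_orbit:
  assumes "finite X" and bij: "bij_betw f X X" and "x \<in> X"
  shows "x \<in> orbit f x"
proof -
  have "bij_betw (perm_restrict f X) X X"
    using bij by (rule bij_betw_cong[THEN iffD1, rotated]) (simp add: perm_restrict_def)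
  then have "perm_restrict f X permutes X"
    by (rule bij_imp_permutes) (simp add: perm_restrict_def)
  then have "x \<in> orbit (perm_restrict f X) x"
    using \<open>finite X\<close> by (intro permutation_self_in_orbit) (auto simp: permutation_permutes)
  also have "orbit (perm_restrict f X) x = orbit f x"
    using bij \<open>x \<in> X\<close> by (intro orbit_cong0[of x X]) (auto simp: perm_restrict_def bij_betw_def)
  finally show ?thesis .
qed

lemma bij_betw_orbit_eq:
  assumes "finite X" "bij_betw f X X" "x \<in> X" "y \<in> orbit f x"
  shows "orbit f y = orbit f x"
  using orbit_swap[OF bij_betw_self_in_orbit[OF assms(1-3)] assms(4)] assms(4)
  by (auto intro: orbit_trans)

lemma orbit_subset_orbit_comp_transpose:
  assumes "a \<notin> orbit f b"
  shows "orbit f b \<subseteq> orbit (f \<circ> transpose a b) a"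
proof
  define g where "g = f \<circ> transpose a b"
  have g: "g a = f b" "\<And>w. w \<noteq> a \<Longrightarrow> w \<noteq> b \<Longrightarrow> g w = f w"
    by (simp_all add: g_def transpose_eq_iff)
  fix w assume "w \<in> orbit f b"
  then have "w \<in> orbit g a"
  proof induction
    case base
    show ?case
      using orbit.base[of g a] by (simp add: g(1))
  next
    case (step w)
    then have "w \<noteq> a"
      using assms by auto
    then show ?case
      using step.IH orbit.base[of g a] orbit.step[of w g a] g by (cases "w = b") simp_all
  qed
  then show "w \<in> orbit (f \<circ> transpose a b) a"
    by (simp only: g_def)
qed

lemma orbit_comp_transpose:
  assumes "finite X" and bij: "bij_betw f X X" and ab: "a \<in> X" "b \<in> X" "b \<notin> orbit f a"
    and u: "u \<in> orbit f a \<union> orbit f b"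
  shows "orbit (f \<circ> transpose a b) u = orbit f a \<union> orbit f b"
proof -
  let ?g = "f \<circ> transpose a b"
  have bij_g: "bij_betw ?g X X"
    using bij ab by (intro bij_betw_trans[OF permutes_imp_bij]) (rule permutes_swap_id)
  note self = bij_betw_self_in_orbit[OF \<open>finite X\<close> bij]
  note orbit_g_eq = bij_betw_orbit_eq[OF \<open>finite X\<close> bij_g]
  have "a \<notin> orbit f b"
    using ab self bij_betw_orbit_eq[OF \<open>finite X\<close> bij] by blast
  then have "orbit f b \<subseteq> orbit ?g a"
    by (rule orbit_subset_orbit_comp_transpose)
  moreover have "orbit f a \<subseteq> orbit ?g b"
    using orbit_subset_orbit_comp_transpose[OF ab(3)] by (simp add: transpose_commute)
  moreover have "orbit ?g b = orbit ?g a"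
    using calculation orbit_g_eq[OF ab(1)] self[OF ab(2)] by blast
  ultimately have union: "orbit f a \<union> orbit f b \<subseteq> orbit ?g a" by blast
  with u have "orbit ?g u = orbit ?g a"
    using orbit_g_eq ab(1) by blast
  moreover have "orbit ?g u \<subseteq> orbit f a \<union> orbit f b"
    using u by (intro orbit_subset_closed) (auto simp: transpose_def intro: orbit.intros)
  ultimately show ?thesis
    using union by blast
qed

lemma card_orbits_comp_transpose:
  assumes "finite X" and bij: "bij_betw f X X" and ab: "a \<in> X" "b \<in> X" "b \<notin> orbit f a"
  shows "card (orbit f ` X) = Suc (card (orbit (f \<circ> transpose a b) ` X))"
proof -
  note self = bij_betw_self_in_orbit[OF \<open>finite X\<close> bij]
  note orbit_eq = bij_betw_orbit_eq[OF \<open>finite X\<close> bij]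
  have merged: "orbit (f \<circ> transpose a b) u =
      (if u \<in> orbit f a \<union> orbit f b then orbit f a \<union> orbit f b else orbit f u)"
    if "u \<in> X" for u
  proof (cases "u \<in> orbit f a \<union> orbit f b")
    case True
    then show ?thesis
      using orbit_comp_transpose[OF assms True] by (simp only: if_True)
  next
    case False
    then have "a \<notin> orbit f u" "b \<notin> orbit f u"
      using orbit_eq[OF that, of a] orbit_eq[OF that, of b] self[OF that] by blast+
    then have "orbit (f \<circ> transpose a b) u = orbit f u"
      using self[OF that] by (intro orbit_cong) (auto simp: transpose_def)
    with False show ?thesis by (simp only: if_False)
  qed
  have "orbit f a \<noteq> orbit f b"
    using ab self by blast
  then show ?thesis
    using card_classes_merge[OF \<open>finite X\<close> ab(1,2) _ self orbit_eq merged] by blast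
qed

inductive first_hit :: "('a \<Rightarrow> 'a) \<Rightarrow> 'a set \<Rightarrow> 'a \<Rightarrow> 'a \<Rightarrow> bool" for f B where
  now: "f d \<in> B \<Longrightarrow> first_hit f B d (f d)"
| later: "f d \<notin> B \<Longrightarrow> first_hit f B (f d) e \<Longrightarrow> first_hit f B d e"

lemma first_hit_in_orbit: "first_hit f B d e \<Longrightarrow> e \<in> orbit f d \<inter> B"
  by (induction rule: first_hit.induct) (auto intro: orbit.base orbit_subset)

lemma first_hit_funpow:
  assumes "0 < n" "(f ^^ n) d \<in> B" "\<And>k. 0 < k \<Longrightarrow> k < n \<Longrightarrow> (f ^^ k) d \<notin> B"
  shows "first_hit f B d ((f ^^ n) d)"
  using assms
proof (induction n arbitrary: d)
  case (Suc n)
  show ?case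
  proof (cases "n = 0")
    case True
    with Suc.prems(2) show ?thesis by (simp add: first_hit.now)
  next
    case False
    have "(f ^^ k) (f d) \<notin> B" if "0 < k" "k < n" for k
      using Suc.prems(3)[of "Suc k"] that by (simp add: funpow_swap1)
    then have "first_hit f B (f d) ((f ^^ n) (f d))"
      using Suc.IH[of "f d"] Suc.prems(2) False by (simp add: funpow_swap1)
    moreover have "f d \<notin> B"
      using Suc.prems(3)[of 1] False by simp
    ultimately show ?thesis
      by (simp add: funpow_swap1 first_hit.later)
  qed
qed simp

lemma first_hit_induced_rot:
  assumes "e \<in> orbit f d" "e \<in> B"
  shows "first_hit f B d (induced_rot f B d)"
proof -
  let ?P = "\<lambda>n. 0 < n \<and> (f ^^ n) d \<in> B"
  have "\<exists>n. ?P n"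
    using assms by (auto simp: orbit_altdef)
  then have "?P (Least ?P)"
    by (rule LeastI_ex)
  then show ?thesis
    unfolding induced_rot_def using not_less_Least[of _ ?P] by (intro first_hit_funpow) auto
qed

lemma first_hit_comp:
  assumes "first_hit g B (\<theta> d) e" and "\<And>x. x \<notin> B \<Longrightarrow> \<theta> x = x"
  shows "first_hit (g \<circ> \<theta>) B d e"
  using assms(1)
proof (induction "\<theta> d" e arbitrary: d rule: first_hit.induct)
  case now
  then show ?case using first_hit.now[of "g \<circ> \<theta>"] by simp
next
  case (later e)
  then have "first_hit (g \<circ> \<theta>) B (g (\<theta> d)) e" using assms(2) by simp
  with later show ?case using first_hit.later[of "g \<circ> \<theta>"] by simp
qed

context
  fixes f :: "'a \<Rightarrow> 'a" and g :: "'b \<Rightarrow> 'b" and h :: "'b \<Rightarrow> 'a" and D :: "'b set"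
  assumes return: "\<And>d. d \<in> D \<Longrightarrow> g d \<in> D"
      "\<And>d. d \<in> D \<Longrightarrow> first_hit f (h ` D) (h d) (h (g d))"
    and inj: "inj_on h D"
begin

lemma orbit_return_map_subset: "d \<in> D \<Longrightarrow> orbit g d \<subseteq> D"
  using return(1) by (rule orbit_subset_closed)

lemma image_orbit_return_map_subset:
  assumes d: "d \<in> D"
  shows "h ` orbit g d \<subseteq> orbit f (h d)"
proof (rule image_subsetI)
  fix e assume "e \<in> orbit g d"
  then show "h e \<in> orbit f (h d)"
  proof induction
    case base
    show ?case using return[OF d] first_hit_in_orbit by fast
  next
    case (step e)
    then have "e \<in> D"
      using orbit_return_map_subset[OF d] by blast
    then have "h (g e) \<in> orbit f (h e)"
      using return(2) first_hit_in_orbit by fast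
    with step.IH show ?case by (rule orbit_trans[rotated])
  qed
qed

lemma orbit_before_first_return:
  assumes d: "d \<in> D" and "x \<in> orbit f (h d)"
  shows "x \<in> h ` orbit g d \<or> x \<notin> h ` D \<and> (\<exists>e\<in>orbit g d. first_hit f (h ` D) x (h e))"
proof -
  have next_hit: "f x \<in> h ` orbit g d \<or>
      f x \<notin> h ` D \<and> (\<exists>e\<in>orbit g d. first_hit f (h ` D) (f x) (h e))"
    if "first_hit f (h ` D) x (h e)" "e \<in> orbit g d" for x e
    using that by (cases rule: first_hit.cases) (metis image_eqI)+
  from assms(2) show ?thesis
  proof induction
    case base
    show ?case using next_hit[OF return(2)[OF d]] orbit.base by fast
  next
    case (step x)
    from step.IH consider e where "x = h e" "e \<in> orbit g d"
      | e where "first_hit f (h ` D) x (h e)" "e \<in> orbit g d" by blast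
    then show ?case
    proof cases
      case 1
      then have "first_hit f (h ` D) x (h (g e))"
        using return(2) orbit_return_map_subset[OF d] by blast
      with 1 show ?thesis using next_hit orbit.step by metis
    qed (use next_hit in blast)
  qed
qed

lemma orbit_first_return:
  assumes d: "d \<in> D"
  shows "orbit g d = {e \<in> D. h e \<in> orbit f (h d)}"
proof -
  note sub = orbit_return_map_subset[OF d]
  have "e \<in> orbit g d" if "e \<in> D" "h e \<in> orbit f (h d)" for e
  proof -
    have "h e \<in> h ` orbit g d"
      using orbit_before_first_return[OF d that(2)] that(1) by blast
    then show ?thesis
      using sub that(1) inj by (auto dest: inj_onD)
  qed
  then show ?thesis
    using sub image_orbit_return_map_subset[OF d] by blast
qed

lemma card_orbits_first_return:
  assumes "finite X" and bij: "bij_betw f X X" and hD: "h ` D \<subseteq> X"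
  shows "card (orbit g ` D) = card (orbit f ` h ` D)"
proof -
  define trace where "trace Z = {e \<in> D. h e \<in> Z}" for Z
  have "orbit g ` D = trace ` orbit f ` h ` D"
    unfolding image_image trace_def by (intro image_cong refl orbit_first_return)
  moreover have "inj_on trace (orbit f ` h ` D)"
  proof (rule inj_onI, clarify)
    fix d e assume "d \<in> D" "e \<in> D" "trace (orbit f (h d)) = trace (orbit f (h e))"
    moreover from this have "h d \<in> orbit f (h e)"
      using hD bij_betw_self_in_orbit[OF \<open>finite X\<close> bij, of "h d"] by (auto simp: trace_def)
    ultimately show "orbit f (h d) = orbit f (h e)"
      using bij_betw_orbit_eq[OF \<open>finite X\<close> bij] hD by blast
  qed
  ultimately show ?thesis by (simp add: card_image)
qed

end

subsection \<open>States of a ribbon graph\<close>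

definition edge_of :: "('v, 'd) pre_ribbon_graph \<Rightarrow> 'd \<Rightarrow> 'd set" where
  "edge_of F d = {d, opp F d}"

lemma in_edge_of: "d \<in> edge_of F d"
  by (simp add: edge_of_def)

lemma edges_eq_image: "edges F = edge_of F ` darts F"
  by (simp add: edges_def edge_of_def)

lemma spanning_sub_simps [simp]:
  "verts (spanning_sub F A) = verts F" "darts (spanning_sub F A) = \<Union>A"
  "vert (spanning_sub F A) = vert F" "opp (spanning_sub F A) = opp F"
  "rot (spanning_sub F A) = induced_rot (rot F) (\<Union>A)"
  by (simp_all add: spanning_sub_def)

definition state_term ::
    "('v, 'd) pre_ribbon_graph \<Rightarrow> 'a::field \<Rightarrow> 'a \<Rightarrow> 'a \<Rightarrow> 'd set set \<Rightarrow> 'a" where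
  "state_term F a b c A = (let H = spanning_sub F A in
     a powi (rk F - rk H) * b powi nul H * c powi (num_k H - num_p H + nul H))"

lemma num_v_spanning_sub [simp]: "num_v (spanning_sub F A) = num_v F"
  by (simp add: num_v_def)

context ribbon_graph
begin

lemma finite_edges: "finite (edges F)"
  by (simp add: edges_def finite_darts)

lemma Union_edges: "\<Union>(edges F) = darts F"
  by (auto simp: edges_def opp_in_darts)

lemma Union_edges_subset: "A \<subseteq> edges F \<Longrightarrow> \<Union>A \<subseteq> darts F"
  using Union_edges by blast

lemma finite_Union_edges: "A \<subseteq> edges F \<Longrightarrow> finite (\<Union>A)"
  using Union_edges_subset finite_darts by (rule finite_subset)

lemma edge_of_opp: "d \<in> darts F \<Longrightarrow> edge_of F (opp F d) = edge_of F d"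
  by (auto simp: edge_of_def opp_opp)

lemma edge_of_eq: "e \<in> edges F \<Longrightarrow> d \<in> e \<Longrightarrow> edge_of F d = e"
  by (auto simp: edges_def edge_of_def opp_opp)

lemma edges_disjoint: "e \<in> edges F \<Longrightarrow> e' \<in> edges F \<Longrightarrow> e \<noteq> e' \<Longrightarrow> e \<inter> e' = {}"
  by (metis disjoint_iff edge_of_eq)

lemma card_Union_edges:
  assumes "A \<subseteq> edges F"
  shows "2 * card A = card (\<Union>A)"
proof (rule card_partition)
  show "finite A" "finite (\<Union>A)"
    using assms finite_edges finite_Union_edges by (auto intro: finite_subset)
  show "card e = 2" if "e \<in> A" for e
  proof -
    obtain d where "d \<in> darts F" "e = {d, opp F d}"
      using assms \<open>e \<in> A\<close> by (auto simp: edges_def)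
    then show ?thesis
      using opp_neq[of d] by (simp add: card_insert_if)
  qed
  show "e \<inter> e' = {}" if "e \<in> A" "e' \<in> A" "e \<noteq> e'" for e e'
    using assms that by (intro edges_disjoint) auto
qed

lemma in_Union_edges_iff:
  assumes "A \<subseteq> edges F"
  shows "d \<in> \<Union>A \<longleftrightarrow> edge_of F d \<in> A \<and> d \<in> darts F"
proof
  assume "d \<in> \<Union>A"
  then obtain e where "e \<in> A" "d \<in> e" by blast
  with assms have "edge_of F d = e" "d \<in> darts F"
    using edge_of_eq Union_edges by blast+
  with \<open>e \<in> A\<close> show "edge_of F d \<in> A \<and> d \<in> darts F" by simp
qed (use in_edge_of[of d F] in blast)

lemma opp_in_Union_edges: "A \<subseteq> edges F \<Longrightarrow> d \<in> \<Union>A \<Longrightarrow> opp F d \<in> \<Union>A"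
  by (simp add: in_Union_edges_iff edge_of_opp opp_in_darts del: Union_iff)

lemma Union_edges_Diff:
  assumes "A \<subseteq> edges F" "B \<subseteq> edges F"
  shows "\<Union>(A - B) = \<Union>A - \<Union>B"
proof -
  have "A - B \<subseteq> edges F"
    using assms by blast
  then have "d \<in> \<Union>(A - B) \<longleftrightarrow> d \<in> \<Union>A - \<Union>B" for d
    using assms by (auto simp add: in_Union_edges_iff simp del: Union_iff)
  then show ?thesis by blast
qed

lemma Union_edges_complement: "A \<subseteq> edges F \<Longrightarrow> \<Union>(edges F - A) = darts F - \<Union>A"
  using Union_edges_Diff[OF subset_refl] by (simp add: Union_edges)

lemma edges_spanning_sub:
  assumes "A \<subseteq> edges F"
  shows "edges (spanning_sub F A) = A"
proof -
  have "edges (spanning_sub F A) = edge_of F ` \<Union>A"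
    by (simp add: edges_def edge_of_def)
  also have "\<dots> = A"
  proof
    show "edge_of F ` \<Union>A \<subseteq> A"
      using in_Union_edges_iff[OF assms] by blast
    show "A \<subseteq> edge_of F ` \<Union>A"
    proof
      fix e assume "e \<in> A"
      moreover from this obtain d where "d \<in> e"
        using assms by (auto simp: edges_eq_image intro: in_edge_of)
      ultimately show "e \<in> edge_of F ` \<Union>A"
        using assms edge_of_eq[of e d] by (intro image_eqI[of _ _ d]) auto
    qed
  qed
  finally show ?thesis .
qed

lemma num_e_spanning_sub: "A \<subseteq> edges F \<Longrightarrow> num_e (spanning_sub F A) = int (card A)"
  by (simp add: num_e_def edges_spanning_sub)

lemma inj_on_spanning_sub: "inj_on (spanning_sub F) (Pow (edges F))"
  by (rule inj_on_inverseI[of _ edges]) (simp add: edges_spanning_sub)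

lemma BR_poly_eq_sum_state_term: "BR_poly F a b c = (\<Sum>A\<in>Pow (edges F). state_term F a b c A)"
proof -
  have "states F = spanning_sub F ` Pow (edges F)"
    by (auto simp: states_def)
  then show ?thesis
    by (simp add: BR_poly_def state_term_def Let_def sum.reindex[OF inj_on_spanning_sub])
qed

lemma adjacency_spanning_sub:
  "adjacency (spanning_sub F A) = (\<lambda>d. (vert F d, vert F (opp F d))) ` \<Union>A"
  by (simp add: adjacency_def)

lemma sym_adjacency_spanning_sub:
  assumes "A \<subseteq> edges F"
  shows "sym (adjacency (spanning_sub F A))"
proof (rule symI)
  fix v w assume "(v, w) \<in> adjacency (spanning_sub F A)"
  then obtain d where "d \<in> \<Union>A" "v = vert F d" "w = vert F (opp F d)"
    unfolding adjacency_spanning_sub by blast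
  moreover have "opp F d \<in> \<Union>A"
    using assms \<open>d \<in> \<Union>A\<close> by (rule opp_in_Union_edges)
  moreover have "opp F (opp F d) = d"
    using in_Union_edges_iff[OF assms] \<open>d \<in> \<Union>A\<close> opp_opp by blast
  ultimately show "(w, v) \<in> adjacency (spanning_sub F A)"
    unfolding adjacency_spanning_sub
    by (intro image_eqI[of _ _ "opp F d"]) (simp_all del: Union_iff)
qed

definition linked :: "'d set set \<Rightarrow> 'v rel" where
  "linked A = (adjacency (spanning_sub F A))\<^sup>*"

lemma equiv_linked: "A \<subseteq> edges F \<Longrightarrow> equiv UNIV (linked A)"
  unfolding linked_def by (intro equiv_rtrancl sym_adjacency_spanning_sub)

lemma components_spanning_sub: "components (spanning_sub F A) = (\<lambda>v. linked A `` {v}) ` verts F"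
  by (auto simp: components_def quotient_def linked_def)

lemma rk_spanning_sub_edges: "rk (spanning_sub F (edges F)) = rk F"
  by (simp add: rk_def num_k_def components_def adjacency_def Union_edges)

subsection \<open>Boundary components of a state\<close>

lemma orbit_rot: "d \<in> darts F \<Longrightarrow> orbit (rot F) d = darts_at F (vert F d)"
  by (rule orbit_cyclic_eq3, rule rot_cyclic) (auto simp: darts_at_def vert_in_verts)

lemma bij_betw_rot: "bij_betw (rot F) (darts F) (darts F)"
proof -
  have "rot F d \<in> darts F \<and> d \<in> rot F ` darts F" if "d \<in> darts F" for d
  proof
    show "rot F d \<in> darts F"
      using orbit.base[of "rot F" d] orbit_rot[OF that] by (simp add: darts_at_def)
    have "d \<in> orbit (rot F) d"
      using that by (simp add: orbit_rot darts_at_def)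
    then show "d \<in> rot F ` darts F"
      by cases (use that orbit_rot[OF that] in \<open>auto simp: darts_at_def\<close>)
  qed
  then have "rot F ` darts F = darts F" by blast
  then show ?thesis
    using finite_surj_inj[OF finite_darts] by (simp add: bij_betw_def)
qed

definition partial_opp :: "'d set set \<Rightarrow> 'd \<Rightarrow> 'd" where
  "partial_opp A d = (if d \<in> \<Union>A then opp F d else d)"

definition state_walk :: "'d set set \<Rightarrow> 'd \<Rightarrow> 'd" where
  "state_walk A = rot F \<circ> partial_opp A"

lemma bij_betw_state_walk:
  assumes "A \<subseteq> edges F"
  shows "bij_betw (state_walk A) (darts F) (darts F)"
proof -
  have "partial_opp A d \<in> darts F \<and> partial_opp A (partial_opp A d) = d" if "d \<in> darts F" for d
    using that opp_in_Union_edges[OF assms, of d]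
    by (auto simp: partial_opp_def opp_in_darts opp_opp simp del: Union_iff)
  then have "bij_betw (partial_opp A) (darts F) (darts F)"
    by (intro bij_betw_byWitness[where f' = "partial_opp A"]) auto
  then show ?thesis
    unfolding state_walk_def using bij_betw_rot by (rule bij_betw_trans)
qed

lemma card_boundary_walks_spanning_sub:
  assumes A: "A \<subseteq> edges F"
  shows "card (boundary_walks (spanning_sub F A)) = card (orbit (state_walk A) ` \<Union>A)"
proof -
  note sub = Union_edges_subset[OF A]
  have hit: "first_hit (rot F) (\<Union>A) (opp F d) (induced_rot (rot F) (\<Union>A) (opp F d))"
    if "d \<in> \<Union>A" for d
  proof (rule first_hit_induced_rot)
    show "opp F d \<in> \<Union>A" using A that by (rule opp_in_Union_edges)
    then show "opp F d \<in> orbit (rot F) (opp F d)"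
      using sub finite_darts bij_betw_rot by (intro bij_betw_self_in_orbit) auto
  qed
  then have return: "first_hit (state_walk A) (\<Union>A) d ((induced_rot (rot F) (\<Union>A) \<circ> opp F) d)"
    if "d \<in> \<Union>A" for d
    unfolding state_walk_def using that
    by (intro first_hit_comp) (simp_all add: partial_opp_def)
  then have "(induced_rot (rot F) (\<Union>A) \<circ> opp F) d \<in> \<Union>A" if "d \<in> \<Union>A" for d
    using that first_hit_in_orbit by fast
  with return have "card (orbit (induced_rot (rot F) (\<Union>A) \<circ> opp F) ` \<Union>A) =
      card (orbit (state_walk A) ` id ` \<Union>A)"
    using finite_darts bij_betw_state_walk[OF A] sub by (intro card_orbits_first_return) auto
  then show ?thesis
    by (simp add: boundary_walks_def)
qed

lemma orbit_state_walk_eq_darts_at: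
  assumes A: "A \<subseteq> edges F" and d: "d \<in> darts F"
    and "darts_at F (vert F d) \<inter> \<Union>A = {} \<or> orbit (state_walk A) d \<inter> \<Union>A = {}"
  shows "orbit (state_walk A) d = darts_at F (vert F d)"
proof -
  have off: "state_walk A x = rot F x" if "x \<notin> \<Union>A" for x
    using that by (simp add: state_walk_def partial_opp_def)
  have self: "d \<in> orbit (rot F) d" "d \<in> orbit (state_walk A) d"
    using bij_betw_self_in_orbit[OF finite_darts _ d] bij_betw_rot bij_betw_state_walk[OF A] by auto
  have "orbit (state_walk A) d = orbit (rot F) d"
    using assms(3)
  proof
    assume "darts_at F (vert F d) \<inter> \<Union>A = {}"
    then show ?thesis
      using orbit_rot[OF d] by (intro orbit_cong self off) auto
  next
    assume "orbit (state_walk A) d \<inter> \<Union>A = {}"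
    then have "orbit (rot F) d = orbit (state_walk A) d"
      by (intro orbit_cong self off[symmetric]) auto
    then show ?thesis ..
  qed
  with orbit_rot[OF d] show ?thesis by simp
qed

definition detached_verts :: "'d set set \<Rightarrow> 'v set" where
  "detached_verts A = {v \<in> verts F. darts_at F v \<noteq> {} \<and> darts_at F v \<inter> \<Union>A = {}}"

lemma finite_detached_verts: "finite (detached_verts A)"
  by (simp add: detached_verts_def finite_verts)

lemma card_isolated_verts_spanning_sub:
  assumes A: "A \<subseteq> edges F"
  shows "card (isolated_verts (spanning_sub F A)) =
    card (isolated_verts F) + card (detached_verts A)"
proof -
  have "darts_at (spanning_sub F A) v = darts_at F v \<inter> \<Union>A" for v
    using Union_edges_subset[OF A] by (auto simp: darts_at_def)
  then have "isolated_verts (spanning_sub F A) = isolated_verts F \<union> detached_verts A"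
    by (auto simp: isolated_verts_def detached_verts_def)
  moreover have "isolated_verts F \<inter> detached_verts A = {}"
    by (auto simp: isolated_verts_def detached_verts_def)
  moreover have "finite (isolated_verts F)"
    by (simp add: isolated_verts_def finite_verts)
  ultimately show ?thesis
    by (simp add: card_Un_disjoint finite_detached_verts)
qed

lemma orbits_state_walk:
  assumes A: "A \<subseteq> edges F"
  shows "orbit (state_walk A) ` darts F =
    orbit (state_walk A) ` \<Union>A \<union> darts_at F ` detached_verts A"
proof
  have "orbit (state_walk A) d \<in> orbit (state_walk A) ` \<Union>A \<union> darts_at F ` detached_verts A"
    if d: "d \<in> darts F" for d
  proof (cases "orbit (state_walk A) d \<inter> \<Union>A = {}")
    case True
    then have "orbit (state_walk A) d = darts_at F (vert F d)"
      using A d by (intro orbit_state_walk_eq_darts_at) auto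
    moreover from this True d have "vert F d \<in> detached_verts A"
      using vert_in_verts by (auto simp: detached_verts_def darts_at_def)
    ultimately show ?thesis by blast
  next
    case False
    then show ?thesis
      using bij_betw_orbit_eq[OF finite_darts bij_betw_state_walk[OF A] d] by blast
  qed
  then show "orbit (state_walk A) ` darts F
      \<subseteq> orbit (state_walk A) ` \<Union>A \<union> darts_at F ` detached_verts A"
    by blast
  have "darts_at F v \<in> orbit (state_walk A) ` darts F" if v: "v \<in> detached_verts A" for v
  proof -
    have "darts_at F v \<noteq> {}"
      using v by (simp add: detached_verts_def)
    then obtain d where d: "d \<in> darts F" "vert F d = v"
      by (auto simp: darts_at_def)
    with v have "orbit (state_walk A) d = darts_at F v"
      using A orbit_state_walk_eq_darts_at[of A d] by (simp add: detached_verts_def)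
    with d show ?thesis by blast
  qed
  with Union_edges_subset[OF A]
  show "orbit (state_walk A) ` \<Union>A \<union> darts_at F ` detached_verts A
      \<subseteq> orbit (state_walk A) ` darts F"
    by blast
qed

lemma card_orbits_state_walk:
  assumes A: "A \<subseteq> edges F"
  shows "card (orbit (state_walk A) ` darts F) =
    card (orbit (state_walk A) ` \<Union>A) + card (detached_verts A)"
proof -
  have "orbit (state_walk A) d \<noteq> darts_at F v" if "d \<in> \<Union>A" "v \<in> detached_verts A" for d v
  proof -
    have "d \<in> orbit (state_walk A) d"
      using finite_darts bij_betw_state_walk[OF A] Union_edges_subset[OF A] that(1)
      by (intro bij_betw_self_in_orbit) auto
    then show ?thesis
      using that by (auto simp: detached_verts_def)
  qed
  then have "orbit (state_walk A) ` \<Union>A \<inter> darts_at F ` detached_verts A = {}" by blast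
  moreover have "inj_on (darts_at F) (detached_verts A)"
    by (rule inj_onI) (auto simp: detached_verts_def darts_at_def)
  ultimately show ?thesis
    unfolding orbits_state_walk[OF A] using finite_Union_edges[OF A] finite_detached_verts
    by (simp add: card_Un_disjoint card_image)
qed

lemma num_p_spanning_sub:
  assumes "A \<subseteq> edges F"
  shows "num_p (spanning_sub F A) =
    int (card (orbit (state_walk A) ` darts F)) + int (card (isolated_verts F))"
  using assms
  by (simp add: num_p_def card_boundary_walks_spanning_sub card_orbits_state_walk
      card_isolated_verts_spanning_sub)

subsection \<open>Pendant edges\<close>

definition pendant :: "'d set set \<Rightarrow> 'd \<Rightarrow> bool" where
  "pendant A d \<longleftrightarrow> darts_at F (vert F d) \<inter> \<Union>A = {d}"

context
  fixes A d
  assumes A: "A \<subseteq> edges F" and pendant: "pendant A d"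
begin

lemma pendant_in_darts: "d \<in> darts F" "d \<in> \<Union>A" "edge_of F d \<in> A"
proof -
  show "d \<in> \<Union>A"
    using pendant unfolding pendant_def by blast
  then show "d \<in> darts F" "edge_of F d \<in> A"
    by (simp_all only: in_Union_edges_iff[OF A])
qed

lemma vert_opp_pendant: "vert F (opp F d) \<noteq> vert F d"
proof
  assume "vert F (opp F d) = vert F d"
  then have "opp F d \<in> darts_at F (vert F d) \<inter> \<Union>A"
    using A pendant_in_darts opp_in_Union_edges opp_in_darts
    by (simp add: darts_at_def del: Union_iff)
  then show False
    using pendant opp_neq[OF pendant_in_darts(1)] unfolding pendant_def by blast
qed

lemma Union_remove_pendant: "\<Union>(A - {edge_of F d}) = \<Union>A - {d, opp F d}"
proof -
  have "{edge_of F d} \<subseteq> edges F"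
    using A pendant_in_darts(3) by blast
  then show ?thesis
    using Union_edges_Diff[OF A] by (simp add: edge_of_def)
qed

lemma darts_at_Int_remove_pendant: "darts_at F (vert F d) \<inter> \<Union>(A - {edge_of F d}) = {}"
  using pendant unfolding pendant_def Union_remove_pendant by blast

lemma num_k_remove_pendant:
  "num_k (spanning_sub F (A - {edge_of F d})) = num_k (spanning_sub F A) + 1"
proof -
  let ?v = "vert F d" and ?w = "vert F (opp F d)"
  define r where "r = adjacency (spanning_sub F (A - {edge_of F d}))"
  have "\<Union>A = \<Union>(A - {edge_of F d}) \<union> {d, opp F d}"
    using pendant_in_darts(3) by (auto simp: edge_of_def)
  then have adj: "adjacency (spanning_sub F A) = r \<union> {(?v, ?w), (?w, ?v)}"
    using pendant_in_darts(1) by (simp add: r_def adjacency_spanning_sub image_Un opp_opp)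
  have "?v \<notin> vert F ` \<Union>(A - {edge_of F d})"
  proof (rule notI, erule imageE)
    fix d' assume d': "?v = vert F d'" "d' \<in> \<Union>(A - {edge_of F d})"
    then have "d' \<in> darts F"
      using A in_Union_edges_iff[of "A - {edge_of F d}" d'] by auto
    with d' show False
      using darts_at_Int_remove_pendant by (simp only: darts_at_def) blast
  qed
  moreover have "Domain r = vert F ` \<Union>(A - {edge_of F d})"
    by (simp add: r_def adjacency_spanning_sub Domain_fst image_image)
  ultimately have "(?v, ?w) \<notin> r\<^sup>*"
    using vert_opp_pendant by (simp add: Not_Domain_rtrancl)
  moreover have "sym r"
    unfolding r_def using A by (intro sym_adjacency_spanning_sub) auto
  ultimately have "card (verts F // r\<^sup>*) =
      Suc (card (verts F // (adjacency (spanning_sub F A))\<^sup>*))"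
    unfolding adj using pendant_in_darts(1)
    by (intro card_quotient_insert_edge) (auto simp: finite_verts vert_in_verts opp_in_darts)
  then show ?thesis
    by (simp add: num_k_def components_def r_def)
qed

lemma num_p_remove_pendant:
  "num_p (spanning_sub F (A - {edge_of F d})) = num_p (spanning_sub F A) + 1"
proof -
  define B where "B = A - {edge_of F d}"
  have B: "B \<subseteq> edges F"
    using A by (auto simp: B_def)
  have "orbit (state_walk B) d = darts_at F (vert F d)"
    using B pendant_in_darts darts_at_Int_remove_pendant
    by (intro orbit_state_walk_eq_darts_at) (auto simp: B_def)
  then have "opp F d \<notin> orbit (state_walk B) d"
    using vert_opp_pendant by (simp add: darts_at_def)
  then have "card (orbit (state_walk B) ` darts F) =
      Suc (card (orbit (state_walk B \<circ> transpose d (opp F d)) ` darts F))"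
    using finite_darts bij_betw_state_walk[OF B] pendant_in_darts(1) opp_in_darts
    by (intro card_orbits_comp_transpose) auto
  moreover have "state_walk B \<circ> transpose d (opp F d) = state_walk A"
  proof
    fix x
    show "(state_walk B \<circ> transpose d (opp F d)) x = state_walk A x"
      using pendant_in_darts opp_in_Union_edges[OF A, of d] opp_opp[of d]
      by (auto simp: state_walk_def partial_opp_def transpose_def B_def Union_remove_pendant
          simp del: Union_iff)
  qed
  ultimately show ?thesis
    using num_p_spanning_sub[OF A] num_p_spanning_sub[OF B] by (simp add: B_def)
qed

end

end

subsection \<open>The tensor product with a cycle\<close>

locale cycle_tensor = ribbon_graph F for F :: "('v, 'd) pre_ribbon_graph" +
  fixes m :: nat  \<comment> \<open>the cycle length is \<open>m + 2\<close>, which spares truncated subtractions\<close>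
begin

abbreviation G :: "('v + ('d \<times> nat) set, 'd \<times> nat) pre_ribbon_graph" where
  "G \<equiv> tensor_cycle F (Suc (Suc m))"

abbreviation new_vert :: "'d \<times> nat \<Rightarrow> ('d \<times> nat) set" where
  "new_vert \<equiv> path_vert F (Suc (Suc m))"

lemma new_vert_eq: "new_vert (d, i) = {(d, i), (opp F d, Suc m - i)}"
  by (simp add: path_vert_def)

lemma tensor_simps [simp]:
  "verts G = Inl ` verts F \<union> Inr ` new_vert ` (darts F \<times> {1..m})"
  "darts G = darts F \<times> {..m}"
  "vert G (d, 0) = Inl (vert F d)"
  "vert G (d, Suc i) = Inr (new_vert (d, Suc i))"
  "opp G (d, i) = (opp F d, m - i)"
  "rot G (d, 0) = (rot F d, 0)"
  "rot G (d, Suc i) = (opp F d, m - i)"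
  by (simp_all add: tensor_cycle_def lessThan_Suc_atMost flip: atLeastLessThanSuc_atLeastAtMost)

lemma in_new_vert: "z \<in> new_vert z"
  by (cases z) (simp add: new_vert_eq)

lemma new_vert_opp:
  assumes "d \<in> darts F" "i \<le> Suc m"
  shows "new_vert (opp F d, Suc m - i) = new_vert (d, i)"
  using assms by (auto simp: new_vert_eq opp_opp)

lemma darts_at_tensor_Inl: "darts_at G (Inl v) = darts_at F v \<times> {0}"
proof -
  have "(d, i) \<in> darts_at G (Inl v) \<longleftrightarrow> (d, i) \<in> darts_at F v \<times> {0}" for d i
    by (cases i) (auto simp: darts_at_def)
  then show ?thesis by auto
qed

lemma darts_at_tensor_Inr:
  assumes "z \<in> darts F \<times> {1..m}"
  shows "darts_at G (Inr (new_vert z)) = new_vert z"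
proof -
  obtain d i where z: "z = (d, i)" "d \<in> darts F" "1 \<le> i" "i \<le> m"
    using assms by auto
  have "z' \<in> darts_at G (Inr (new_vert z)) \<longleftrightarrow> z' \<in> darts F \<times> {1..m} \<and> new_vert z' = new_vert z"
    for z'
    by (cases z'; cases "snd z'") (auto simp: darts_at_def)
  moreover have "z' \<in> darts F \<times> {1..m} \<and> new_vert z' = new_vert z \<longleftrightarrow> z' \<in> new_vert z" for z'
  proof
    assume "z' \<in> darts F \<times> {1..m} \<and> new_vert z' = new_vert z"
    then show "z' \<in> new_vert z"
      using in_new_vert by metis
  next
    assume "z' \<in> new_vert z"
    then have "z' = (d, i) \<or> z' = (opp F d, Suc m - i)"
      by (simp add: new_vert_eq z(1))
    then show "z' \<in> darts F \<times> {1..m} \<and> new_vert z' = new_vert z"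
      using z new_vert_opp[of d i] opp_in_darts by auto
  qed
  ultimately show ?thesis by blast
qed

lemma orbit_rot_tensor_new_vert:
  assumes "z \<in> darts F \<times> {1..m}"
  shows "orbit (rot G) z = new_vert z"
proof -
  obtain d i where z: "z = (d, Suc i)" "d \<in> darts F" "i < m"
    using assms by (cases z; cases "snd z") auto
  have "rot G z = (opp F d, m - i)"
    using z by simp
  moreover have "m - i = Suc (m - Suc i)"
    using z by simp
  then have "rot G (opp F d, m - i) = z"
    using z by (simp add: opp_opp)
  ultimately show ?thesis
    by (simp add: orbit_involution new_vert_eq z(1))
qed

sublocale G: ribbon_graph G
proof
  show "finite (verts G)" "finite (darts G)"
    using finite_verts finite_darts by simp_all
next
  fix z assume "z \<in> darts G"
  then obtain d i where z: "z = (d, i)" "d \<in> darts F" "i \<le> m" by auto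
  show "vert G z \<in> verts G"
    using z by (cases i) (auto simp: vert_in_verts)
  show "opp G z \<in> darts G" "opp G z \<noteq> z" "opp G (opp G z) = z"
    using z opp_in_darts opp_neq opp_opp by auto
next
  fix x assume "x \<in> verts G" and nonempty: "darts_at G x \<noteq> {}"
  then consider v where "v \<in> verts F" "x = Inl v"
    | z where "z \<in> darts F \<times> {1..m}" "x = Inr (new_vert z)" by auto
  then show "cyclic_on (rot G) (darts_at G x)"
  proof cases
    case (1 v)
    with nonempty have "cyclic_on (rot F) (darts_at F v)"
      by (intro rot_cyclic) (auto simp: darts_at_tensor_Inl)
    then have "cyclic_on (rot G) ((\<lambda>d. (d, 0)) ` darts_at F v)"
      by (rule cyclic_on_image) simp
    also have "(\<lambda>d. (d, 0)) ` darts_at F v = darts_at F v \<times> {0}" by auto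
    finally show ?thesis
      by (simp add: 1 darts_at_tensor_Inl)
  next
    case (2 z)
    then show ?thesis
      by (simp add: cyclic_on_singleI[OF in_new_vert] orbit_rot_tensor_new_vert darts_at_tensor_Inr)
  qed
qed

definition new_verts :: "'d set set \<Rightarrow> ('d \<times> nat) set set" where
  "new_verts B = new_vert ` (\<Union>B \<times> {1..m})"

lemma finite_new_verts: "B \<subseteq> edges F \<Longrightarrow> finite (new_verts B)"
  by (simp add: new_verts_def finite_Union_edges del: finite_Union)

lemma Union_new_verts:
  assumes B: "B \<subseteq> edges F"
  shows "\<Union>(new_verts B) = \<Union>B \<times> {1..m}"
proof -
  have "new_vert z \<subseteq> \<Union>B \<times> {1..m}" if "z \<in> \<Union>B \<times> {1..m}" for z
    using that opp_in_Union_edges[OF B, of "fst z"]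
    by (cases z) (auto simp add: new_vert_eq simp del: Union_iff UnionE)
  then show ?thesis
    using in_new_vert unfolding new_verts_def by blast
qed

lemma vert_in_new_verts:
  assumes B: "B \<subseteq> edges F" and "x \<in> new_verts B" "z \<in> darts G"
  shows "vert G z = Inr x \<longleftrightarrow> z \<in> x"
proof -
  obtain z' where "z' \<in> \<Union>B \<times> {1..m}" "x = new_vert z'"
    using assms(2) unfolding new_verts_def by blast
  moreover from this have "darts_at G (Inr (new_vert z')) = new_vert z'"
    using Union_edges_subset[OF B] by (intro darts_at_tensor_Inr) auto
  ultimately show ?thesis
    using assms(3) unfolding darts_at_def by blast
qed

lemma card_new_verts:
  assumes B: "B \<subseteq> edges F"
  shows "card (new_verts B) = m * card B"
proof -
  note Union = Union_new_verts[OF B] and sub = Union_edges_subset[OF B]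
  have "2 * card (new_verts B) = card (\<Union>(new_verts B))"
  proof (rule card_partition)
    show "finite (\<Union>(new_verts B))"
      unfolding Union using finite_Union_edges[OF B] by (rule finite_cartesian_product) simp
    show "finite (new_verts B)"
      using B by (rule finite_new_verts)
    show "card x = 2" if "x \<in> new_verts B" for x
      using that sub opp_neq by (fastforce simp: new_verts_def new_vert_eq card_2_iff)
    show "x \<inter> y = {}" if "x \<in> new_verts B" "y \<in> new_verts B" "x \<noteq> y" for x y
    proof (rule ccontr)
      assume "x \<inter> y \<noteq> {}"
      then obtain z where z: "z \<in> x" "z \<in> y" by blast
      with that(1) have "z \<in> \<Union>B \<times> {1..m}"
        unfolding Union[symmetric] by blast
      then have "z \<in> darts G"
        using sub by auto
      then show False
        using z that vert_in_new_verts[OF B] by (metis Inr_inject)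
    qed
  qed
  also have "\<dots> = 2 * (m * card B)"
    by (simp add: Union card_cartesian_product flip: card_Union_edges[OF B])
  finally show ?thesis by simp
qed

lemma verts_tensor_eq: "verts G = Inl ` verts F \<union> Inr ` new_verts (edges F)"
  by (simp add: new_verts_def Union_edges)

lemma num_v_tensor: "num_v G = num_v F + int m * num_e F"
proof -
  have "card (verts G) = card (verts F) + m * card (edges F)"
    unfolding verts_tensor_eq
    by (subst card_Un_disjoint)
      (auto simp: finite_verts finite_new_verts card_image card_new_verts)
  then show ?thesis
    by (simp add: num_v_def num_e_def)
qed

definition path_edges :: "'d set set \<Rightarrow> ('d \<times> nat) set set" where
  "path_edges B = edge_of G ` (\<Union>B \<times> {..m})"

lemma edges_tensor: "edges G = path_edges (edges F)"
  by (simp add: edges_eq_image[of G] path_edges_def Union_edges)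

lemma path_edges_mono: "A \<subseteq> B \<Longrightarrow> path_edges A \<subseteq> path_edges B"
  unfolding path_edges_def by (intro image_mono Sigma_mono Union_mono order_refl)

lemma path_edges_subset: "B \<subseteq> edges F \<Longrightarrow> path_edges B \<subseteq> edges G"
  unfolding edges_tensor by (rule path_edges_mono)

lemma path_edges_UN: "path_edges B = (\<Union>e\<in>B. path_edges {e})"
  by (simp add: path_edges_def Sigma_Union image_UN)

lemma Union_path_edges:
  assumes "B \<subseteq> edges F"
  shows "\<Union>(path_edges B) = \<Union>B \<times> {..m}"
proof -
  have "z \<in> edge_of G z" "edge_of G z \<subseteq> \<Union>B \<times> {..m}" if "z \<in> \<Union>B \<times> {..m}" for z
    using that opp_in_Union_edges[OF assms, of "fst z"]
    by (cases z; simp add: edge_of_def del: Union_iff)+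
  then show ?thesis
    unfolding path_edges_def by blast
qed

lemma edge_of_in_path_edges_iff:
  assumes "B \<subseteq> edges F" "z \<in> darts G"
  shows "edge_of G z \<in> path_edges B \<longleftrightarrow> fst z \<in> \<Union>B"
  using G.in_Union_edges_iff[OF path_edges_subset[OF assms(1)], of z] assms
  by (cases z) (simp add: Union_path_edges del: Union_iff)

lemma card_path_edges:
  assumes "B \<subseteq> edges F"
  shows "card (path_edges B) = Suc m * card B"
  using G.card_Union_edges[OF path_edges_subset[OF assms]]
  by (simp add: Union_path_edges[OF assms] card_cartesian_product algebra_simps
      flip: card_Union_edges[OF assms])

lemma card_path_edges_singleton: "e \<in> edges F \<Longrightarrow> card (path_edges {e}) = Suc m"
  using card_path_edges[of "{e}"] by simp

lemma edge_of_tensor_opp: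
  "d \<in> darts F \<Longrightarrow> i \<le> m \<Longrightarrow> edge_of G (opp F d, m - i) = edge_of G (d, i)"
  using G.edge_of_opp[of "(d, i)"] by simp

lemma path_edges_edge_of:
  assumes "d \<in> darts F"
  shows "path_edges {edge_of F d} = (\<lambda>i. edge_of G (d, i)) ` {..m}"
proof -
  have "edge_of G (opp F d, i) \<in> (\<lambda>i. edge_of G (d, i)) ` {..m}" if "i \<le> m" for i
    using edge_of_tensor_opp[OF assms, of "m - i"] that by simp
  then show ?thesis
    by (auto simp: path_edges_def edge_of_def[of F])
qed

lemma disjoint_family_path_edges: "disjoint_family_on (\<lambda>e. path_edges {e}) (edges F)"
  unfolding disjoint_family_on_def
proof (intro ballI impI)
  fix e e' assume e: "e \<in> edges F" "e' \<in> edges F" "e \<noteq> e'"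
  show "path_edges {e} \<inter> path_edges {e'} = {}"
  proof (rule ccontr)
    assume "path_edges {e} \<inter> path_edges {e'} \<noteq> {}"
    then obtain z where z: "z \<in> e \<times> {..m}" "edge_of G z \<in> path_edges {e'}"
      by (auto simp: path_edges_def)
    then have "z \<in> darts G"
      using e(1) Union_edges by auto
    then have "fst z \<in> e'"
      using edge_of_in_path_edges_iff[of "{e'}" z] e(2) z(2) by simp
    then show False
      using edges_disjoint[OF e] z(1) by auto
  qed
qed

subsection \<open>Boundary components of a subdivision\<close>

lemma state_walk_path_edges:
  assumes A: "A \<subseteq> edges F" and d: "d \<in> darts F"
  shows "d \<in> \<Union>A \<Longrightarrow> i < m \<Longrightarrow> G.state_walk (path_edges A) (d, i) = (d, Suc i)"
    and "d \<in> \<Union>A \<Longrightarrow> G.state_walk (path_edges A) (d, m) = (state_walk A d, 0)"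
    and "d \<notin> \<Union>A \<Longrightarrow> G.state_walk (path_edges A) (d, 0) = (state_walk A d, 0)"
proof -
  show "G.state_walk (path_edges A) (d, i) = (d, Suc i)" if "d \<in> \<Union>A" "i < m"
  proof -
    have "m - i = Suc (m - Suc i)"
      using \<open>i < m\<close> by simp
    then show ?thesis
      using that d
      by (simp add: G.state_walk_def G.partial_opp_def Union_path_edges[OF A] opp_opp
          del: Union_iff)
  qed
qed (simp_all add: G.state_walk_def state_walk_def G.partial_opp_def partial_opp_def
    Union_path_edges[OF A] del: Union_iff)

lemma first_hit_path_edges:
  assumes A: "A \<subseteq> edges F" and d: "d \<in> \<Union>A" and "i \<le> m"
  shows "first_hit (G.state_walk (path_edges A)) (darts F \<times> {0}) (d, i) (state_walk A d, 0)"
proof -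
  have "d \<in> darts F"
    using Union_edges_subset[OF A] d by blast
  note walk = state_walk_path_edges(1,2)[OF A this d]
  from \<open>i \<le> m\<close> show ?thesis
  proof (induction rule: inc_induct)
    case base
    have "state_walk A d \<in> darts F"
      using bij_betw_state_walk[OF A] \<open>d \<in> darts F\<close> by (rule bij_betwE[THEN bspec])
    then show ?case
      using first_hit.now[of "G.state_walk (path_edges A)" "(d, m)"] by (simp add: walk)
  next
    case (step i)
    then show ?case
      using first_hit.later[of "G.state_walk (path_edges A)" "(d, i)"] by (simp add: walk)
  qed
qed

lemma orbit_state_walk_path_edges:
  assumes A: "A \<subseteq> edges F" and d: "d \<in> \<Union>A" and "i \<le> m"
  shows "orbit (G.state_walk (path_edges A)) (d, i) = orbit (G.state_walk (path_edges A)) (d, 0)"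
  using \<open>i \<le> m\<close>
proof (induction i)
  case (Suc i)
  have "d \<in> darts F"
    using Union_edges_subset[OF A] d by blast
  then have "G.state_walk (path_edges A) (d, i) = (d, Suc i)"
    using A d Suc.prems by (intro state_walk_path_edges) auto
  moreover have "(d, i) \<in> orbit (G.state_walk (path_edges A)) (d, i)"
    using G.bij_betw_state_walk[OF path_edges_subset[OF A]] G.finite_darts \<open>d \<in> darts F\<close> Suc.prems
    by (intro bij_betw_self_in_orbit) auto
  ultimately show ?case
    using self_in_orbit_step[of "(d, i)" "G.state_walk (path_edges A)"] Suc by simp
qed simp

lemma orbit_state_walk_new_vert:
  assumes A: "A \<subseteq> edges F" and z: "z \<in> \<Union>(edges F - A) \<times> {1..m}"
  shows "orbit (G.state_walk (path_edges A)) z = new_vert z"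
proof -
  have z': "z \<in> darts F \<times> {1..m}"
    using z unfolding Union_edges_complement[OF A] by auto
  have "new_vert z \<subseteq> \<Union>(edges F - A) \<times> {1..m}"
    using Union_new_verts[of "edges F - A"] z unfolding new_verts_def by blast
  then have "new_vert z \<inter> \<Union>(path_edges A) = {}"
    unfolding Union_path_edges[OF A] Union_edges_complement[OF A] by blast
  moreover have "darts_at G (Inr (new_vert z)) = new_vert z"
    using z' by (rule darts_at_tensor_Inr)
  moreover from this have "z \<in> darts_at G (Inr (new_vert z))"
    using in_new_vert by simp
  then have "z \<in> darts G" "vert G z = Inr (new_vert z)"
    by (simp_all only: darts_at_def mem_Collect_eq)
  ultimately show ?thesis
    using G.orbit_state_walk_eq_darts_at[OF path_edges_subset[OF A], of z] by simp
qed

lemma card_orbits_path_edges: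
  assumes A: "A \<subseteq> edges F"
  shows "card (orbit (G.state_walk (path_edges A)) ` (darts F \<times> {0})) =
    card (orbit (state_walk A) ` darts F)"
proof -
  define h :: "'d \<Rightarrow> 'd \<times> nat" where "h d = (d, 0)" for d
  have h_image: "h ` darts F = darts F \<times> {0}"
    by (auto simp: h_def)
  have closed: "state_walk A d \<in> darts F" if "d \<in> darts F" for d
    using bij_betw_state_walk[OF A] that by (rule bij_betwE[THEN bspec])
  have "first_hit (G.state_walk (path_edges A)) (h ` darts F) (h d) (h (state_walk A d))"
    if d: "d \<in> darts F" for d
  proof (cases "d \<in> \<Union>A")
    case True
    then show ?thesis
      using first_hit_path_edges[OF A] by (simp add: h_image) (simp add: h_def)
  next
    case False
    then have "G.state_walk (path_edges A) (h d) = h (state_walk A d)"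
      using A d by (simp add: state_walk_path_edges h_def)
    then show ?thesis
      using first_hit.now[of "G.state_walk (path_edges A)" "h d"] closed[OF d] by simp
  qed
  then show ?thesis
    using G.finite_darts G.bij_betw_state_walk[OF path_edges_subset[OF A]] closed
    unfolding h_image[symmetric]
    by (intro card_orbits_first_return[symmetric, where X = "darts G"])
      (auto simp: h_def inj_on_def)
qed

lemma orbits_path_edges:
  assumes A: "A \<subseteq> edges F"
  shows "orbit (G.state_walk (path_edges A)) ` darts G =
    orbit (G.state_walk (path_edges A)) ` (darts F \<times> {0}) \<union> new_verts (edges F - A)"
proof
  note new = orbit_state_walk_new_vert[OF A]
  show "orbit (G.state_walk (path_edges A)) ` darts G
    \<subseteq> orbit (G.state_walk (path_edges A)) ` (darts F \<times> {0}) \<union> new_verts (edges F - A)"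
  proof (rule image_subsetI)
    fix z assume "z \<in> darts G"
    then obtain d i where z: "z = (d, i)" "d \<in> darts F" "i \<le> m" by auto
    consider "i = 0" | "d \<in> \<Union>A" | "z \<in> \<Union>(edges F - A) \<times> {1..m}"
      unfolding Union_edges_complement[OF A] using z by (cases i) auto
    then show "orbit (G.state_walk (path_edges A)) z
      \<in> orbit (G.state_walk (path_edges A)) ` (darts F \<times> {0}) \<union> new_verts (edges F - A)"
    proof cases
      case 2
      then show ?thesis
        using orbit_state_walk_path_edges[OF A 2 z(3)] z
        by (intro UnI1 image_eqI[of _ _ "(d, 0)"]) simp_all
    next
      case 3
      then show ?thesis
        unfolding new[OF 3] new_verts_def by blast
    qed (use z in auto)
  qed
  have "new_verts (edges F - A) = orbit (G.state_walk (path_edges A)) ` (\<Union>(edges F - A) \<times> {1..m})"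
    unfolding new_verts_def by (intro image_cong refl new[symmetric])
  also have "\<dots> \<subseteq> orbit (G.state_walk (path_edges A)) ` darts G"
    unfolding Union_edges_complement[OF A] by (intro image_mono) auto
  finally show "orbit (G.state_walk (path_edges A)) ` (darts F \<times> {0}) \<union> new_verts (edges F - A)
    \<subseteq> orbit (G.state_walk (path_edges A)) ` darts G" by auto
qed

lemma isolated_verts_tensor: "isolated_verts G = Inl ` isolated_verts F"
proof -
  have "darts_at G (Inr (new_vert z)) \<noteq> {}" if "z \<in> darts F \<times> {1..m}" for z
    by (metis darts_at_tensor_Inr[OF that] in_new_vert empty_iff)
  then show ?thesis
    by (fastforce simp: isolated_verts_def darts_at_tensor_Inl)
qed

lemma num_p_path_edges:
  assumes A: "A \<subseteq> edges F"
  shows "num_p (spanning_sub G (path_edges A)) =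
    num_p (spanning_sub F A) + int m * int (card (edges F - A))"
proof -
  let ?\<psi> = "G.state_walk (path_edges A)"
  have "orbit ?\<psi> ` (darts F \<times> {0}) \<inter> new_verts (edges F - A) = {}"
  proof -
    have "z \<in> orbit ?\<psi> z" if "z \<in> darts F \<times> {0}" for z
      using G.finite_darts G.bij_betw_state_walk[OF path_edges_subset[OF A]]
      by (rule bij_betw_self_in_orbit) (use that in auto)
    moreover have "z \<notin> x" if "z \<in> darts F \<times> {0}" "x \<in> new_verts (edges F - A)" for z x
      using that by (auto simp: new_verts_def new_vert_eq)
    ultimately show ?thesis by blast
  qed
  then have "card (orbit ?\<psi> ` darts G) =
      card (orbit (state_walk A) ` darts F) + m * card (edges F - A)"
    unfolding orbits_path_edges[OF A]
    by (simp add: card_Un_disjoint finite_darts finite_new_verts card_new_verts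
        card_orbits_path_edges[OF A])
  then show ?thesis
    using num_p_spanning_sub[OF A] G.num_p_spanning_sub[OF path_edges_subset[OF A]]
    by (simp add: card_image isolated_verts_tensor)
qed

subsection \<open>Components of a subdivision\<close>

lemma vert_opp_tensor:
  assumes "d \<in> darts F" "i < m"
  shows "vert G (opp G (d, i)) = vert G (d, Suc i)"
proof -
  have "m - i = Suc (m - Suc i)"
    using assms by simp
  moreover from this have "vert G (opp F d, m - i) = Inr (new_vert (opp F d, Suc m - Suc i))"
    by simp
  ultimately show ?thesis
    using new_vert_opp[of d "Suc i"] assms by simp
qed

lemma vert_tensor_eqD:
  assumes "vert G (d, i) = vert G (d', i')"
  shows "d' = d \<or> d' = opp F d \<or> vert F d' = vert F d"
  using assms by (cases i; cases i') (auto simp: new_vert_eq doubleton_eq_iff)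

context
  fixes A
  assumes A: "A \<subseteq> edges F"
begin

lemma adjacency_path_edgesI:
  assumes "d \<in> \<Union>A" "i \<le> m"
  shows "(vert G (d, i), vert G (opp G (d, i))) \<in> adjacency (spanning_sub G (path_edges A))"
proof -
  have "(d, i) \<in> \<Union>A \<times> {..m}"
    using assms by simp
  then show ?thesis
    unfolding G.adjacency_spanning_sub Union_path_edges[OF A] by (rule imageI)
qed

lemma linked_along_path:
  assumes d: "d \<in> \<Union>A" and "i \<le> m"
  shows "(Inl (vert F d), vert G (d, i)) \<in> G.linked (path_edges A)"
  using \<open>i \<le> m\<close> unfolding G.linked_def
proof (induction i)
  case (Suc i)
  have "vert G (opp G (d, i)) = vert G (d, Suc i)"
    using Union_edges_subset[OF A] d Suc.prems by (intro vert_opp_tensor) auto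
  then have "(vert G (d, i), vert G (d, Suc i)) \<in> adjacency (spanning_sub G (path_edges A))"
    using adjacency_path_edgesI[OF d, of i] Suc.prems by (simp only: Suc_leD)
  with Suc show ?case by (auto intro: rtrancl_into_rtrancl)
qed simp

lemma linked_path_edgesD:
  assumes "(Inl v, Inl w) \<in> G.linked (path_edges A)"
  shows "(v, w) \<in> linked A"
proof -
  \<comment> \<open>A new vertex has no counterpart in \<open>F\<close>, so the invariant along the walk from \<open>Inl v\<close> also
    speaks about the ends of the edges whose paths run through the vertex reached.\<close>
  let ?attached = "\<lambda>x. (\<forall>w. x = Inl w \<longrightarrow> (v, w) \<in> linked A) \<and>
    (\<forall>d i. d \<in> \<Union>A \<longrightarrow> x = vert G (d, i) \<longrightarrow> (v, vert F d) \<in> linked A)"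
  have refl: "(v, v) \<in> linked A"
    by (simp add: linked_def)
  from assms have "?attached (Inl w)"
    unfolding G.linked_def
  proof induction
    case base
    have "vert F d = v" if "Inl v = vert G (d, i)" for d i
      using that by (cases i) auto
    with refl show ?case by auto
  next
    case (step x y)
    then obtain d i where d: "d \<in> \<Union>A" "i \<le> m" "x = vert G (d, i)" "y = vert G (opp G (d, i))"
      unfolding G.adjacency_spanning_sub Union_path_edges[OF A] by blast
    have near_end: "(v, vert F d) \<in> linked A"
      using step.IH d by blast
    then have far_end: "(v, vert F (opp F d)) \<in> linked A"
      using d(1) unfolding linked_def adjacency_spanning_sub by (blast intro: rtrancl_into_rtrancl)
    have y: "y = vert G (opp F d, m - i)"
      using d by simp
    have "(v, w) \<in> linked A" if "y = Inl w" for w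
      using that far_end by (cases "m - i") (auto simp: y)
    moreover have "(v, vert F d') \<in> linked A" if "d' \<in> \<Union>A" "y = vert G (d', i')" for d' i'
    proof -
      have "opp F (opp F d) = d"
        using Union_edges_subset[OF A] d(1) opp_opp by blast
      then have "d' = opp F d \<or> d' = d \<or> vert F d' = vert F (opp F d)"
        using vert_tensor_eqD[of "opp F d" "m - i" d' i'] that(2) y by simp
      then show ?thesis
        using near_end far_end by auto
    qed
    ultimately show ?case by blast
  qed
  then show ?thesis by blast
qed

lemma linked_path_edgesI:
  assumes "(v, w) \<in> linked A"
  shows "(Inl v, Inl w) \<in> G.linked (path_edges A)"
  using assms unfolding linked_def
proof induction
  case base
  show ?case by (simp add: G.linked_def)
next
  case (step w x)
  then obtain d where d: "d \<in> \<Union>A" "w = vert F d" "x = vert F (opp F d)"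
    unfolding adjacency_spanning_sub by blast
  have "(vert G (d, m), Inl x) \<in> adjacency (spanning_sub G (path_edges A))"
    using adjacency_path_edgesI[OF d(1) order_refl] d by simp
  with step.IH linked_along_path[OF d(1) order_refl] d show ?case
    unfolding G.linked_def by (auto intro: rtrancl_trans)
qed

lemma linked_new_vert:
  assumes "x \<in> new_verts (edges F - A)"
  shows "G.linked (path_edges A) `` {Inr x} = {Inr x}"
proof -
  have "x \<inter> \<Union>A \<times> {..m} = {}"
    using assms Union_new_verts[of "edges F - A"] Union_edges_complement[OF A] by auto
  then have "Inr x \<notin> vert G ` (\<Union>A \<times> {..m})"
    using assms vert_in_new_verts[of "edges F - A" x] Union_edges_subset[OF A] by fastforce
  moreover have "Domain (adjacency (spanning_sub G (path_edges A))) = vert G ` (\<Union>A \<times> {..m})"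
    unfolding G.adjacency_spanning_sub Union_path_edges[OF A] by (simp add: Domain_fst image_image)
  ultimately have "Inr x \<notin> Domain (adjacency (spanning_sub G (path_edges A)))"
    by simp
  then show ?thesis
    by (auto simp: G.linked_def Not_Domain_rtrancl)
qed

lemma components_path_edges:
  "components (spanning_sub G (path_edges A)) =
    (\<lambda>v. G.linked (path_edges A) `` {Inl v}) ` verts F \<union> (\<lambda>x. {Inr x}) ` new_verts (edges F - A)"
proof -
  let ?class = "\<lambda>x. G.linked (path_edges A) `` {x}"
  have "\<Union>(edges F) = \<Union>A \<union> \<Union>(edges F - A)"
    using A by blast
  then have "new_verts (edges F) = new_verts A \<union> new_verts (edges F - A)"
    by (simp only: new_verts_def Sigma_Un_distrib1 image_Un)
  then have "components (spanning_sub G (path_edges A)) = (\<lambda>v. ?class (Inl v)) ` verts F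
      \<union> (\<lambda>x. ?class (Inr x)) ` new_verts A \<union> (\<lambda>x. ?class (Inr x)) ` new_verts (edges F - A)"
    unfolding G.components_spanning_sub verts_tensor_eq
    by (simp only: image_Un image_image Un_assoc)
  moreover have "(\<lambda>x. ?class (Inr x)) ` new_verts A \<subseteq> (\<lambda>v. ?class (Inl v)) ` verts F"
  proof (rule image_subsetI)
    fix x assume "x \<in> new_verts A"
    then obtain z where z: "z \<in> \<Union>A \<times> {1..m}" "x = new_vert z"
      unfolding new_verts_def by blast
    obtain d i where "z = (d, i)" by (cases z)
    with z have d: "d \<in> \<Union>A" "i \<le> m" by simp_all
    have "vert G (d, i) = Inr x"
      using vert_in_new_verts[OF A \<open>x \<in> new_verts A\<close>, of z] Union_edges_subset[OF A] d z
        in_new_vert[of z] \<open>z = (d, i)\<close> by auto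
    then have "?class (Inr x) = ?class (Inl (vert F d))"
      using linked_along_path[OF d] G.equiv_linked[OF path_edges_subset[OF A]]
      by (simp add: equiv_class_eq_iff)
    moreover have "vert F d \<in> verts F"
      using d(1) Union_edges_subset[OF A] vert_in_verts by blast
    ultimately show "?class (Inr x) \<in> (\<lambda>v. ?class (Inl v)) ` verts F" by blast
  qed
  moreover have "(\<lambda>x. ?class (Inr x)) ` new_verts (edges F - A) =
      (\<lambda>x. {Inr x}) ` new_verts (edges F - A)"
    by (rule image_cong[OF refl linked_new_vert])
  ultimately show ?thesis by (simp only: Un_absorb2)
qed

lemma card_components_path_edges:
  "card ((\<lambda>v. G.linked (path_edges A) `` {Inl v}) ` verts F) = card (components (spanning_sub F A))"
proof -
  let ?class = "\<lambda>v. G.linked (path_edges A) `` {Inl v}"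
  have equiv: "equiv UNIV (G.linked (path_edges A))"
    using path_edges_subset[OF A] by (rule G.equiv_linked)
  have "Inl -` ?class v = linked A `` {v}" for v
    using linked_path_edgesD linked_path_edgesI by blast
  then have "components (spanning_sub F A) = vimage Inl ` ?class ` verts F"
    by (simp add: components_spanning_sub image_image)
  moreover have "inj_on (vimage Inl) (?class ` verts F)"
  proof (rule inj_onI, clarify)
    fix v w assume "Inl -` ?class v = Inl -` ?class w"
    moreover have "v \<in> Inl -` ?class v"
      using equiv by (simp add: equiv_class_eq_iff)
    ultimately have "(Inl w, Inl v) \<in> G.linked (path_edges A)" by simp
    then show "?class v = ?class w"
      using equiv by (simp add: equiv_class_eq_iff)
  qed
  ultimately show ?thesis by (simp add: card_image)
qed

lemma num_k_path_edges:
  "num_k (spanning_sub G (path_edges A)) =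
    num_k (spanning_sub F A) + int m * int (card (edges F - A))"
proof -
  have "Inl v \<in> G.linked (path_edges A) `` {Inl v}" for v
    by (simp add: G.linked_def)
  then have "(\<lambda>v. G.linked (path_edges A) `` {Inl v}) ` verts F
      \<inter> (\<lambda>x. {Inr x}) ` new_verts (edges F - A) = {}"
    by blast
  then have "card (components (spanning_sub G (path_edges A))) =
      card (components (spanning_sub F A)) + m * card (edges F - A)"
    unfolding components_path_edges card_components_path_edges[symmetric]
    by (simp add: card_Un_disjoint card_image inj_on_def card_new_verts finite_new_verts
        finite_verts)
  then show ?thesis
    by (simp add: num_k_def)
qed

end

subsection \<open>States of the tensor product\<close>

definition whole_edges :: "('d \<times> nat) set set \<Rightarrow> 'd set set" where
  "whole_edges X = {e \<in> edges F. path_edges {e} \<subseteq> X}"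

lemma whole_edges_subset: "whole_edges X \<subseteq> edges F"
  by (auto simp: whole_edges_def)

lemma path_edges_whole_edges: "path_edges (whole_edges X) \<subseteq> X"
  unfolding path_edges_UN[of "whole_edges X"] by (auto simp: whole_edges_def)

lemma whole_edges_edges_tensor: "whole_edges (edges G) = edges F"
  using path_edges_subset by (auto simp: whole_edges_def)

lemma whole_edges_remove:
  assumes "x \<notin> path_edges (whole_edges X)"
  shows "whole_edges (X - {x}) = whole_edges X"
proof -
  have "x \<notin> path_edges {e}" if "e \<in> whole_edges X" for e
    using assms that path_edges_mono[of "{e}" "whole_edges X"] by auto
  then show ?thesis
    by (auto simp: whole_edges_def)
qed

lemma pendant_along_path:
  assumes X: "X \<subseteq> edges G" and d: "d \<in> darts F" and "k < m"
    and "edge_of G (d, k) \<notin> X" and "edge_of G (d, Suc k) \<in> X"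
  shows "G.pendant X (d, Suc k)"
proof -
  have "darts_at G (vert G (d, Suc k)) = {(d, Suc k), (opp F d, m - k)}"
    using darts_at_tensor_Inr[of "(d, Suc k)"] d \<open>k < m\<close> by (simp add: new_vert_eq)
  moreover have "(opp F d, m - k) \<notin> \<Union>X"
    using assms(4) edge_of_tensor_opp[OF d, of k] \<open>k < m\<close>
    by (simp add: G.in_Union_edges_iff[OF X] del: Union_iff)
  moreover have "(d, Suc k) \<in> \<Union>X"
    using assms(5) in_edge_of[of "(d, Suc k)" G] by blast
  ultimately show ?thesis
    by (auto simp: G.pendant_def simp del: Union_iff)
qed

lemma exists_pendant_edge_along_path:
  assumes X: "X \<subseteq> edges G" and d: "d \<in> darts F" and "j < i" "i \<le> m"
    and "edge_of G (d, j) \<notin> X" "edge_of G (d, i) \<in> X"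
  shows "\<exists>z. G.pendant X z \<and> edge_of G z \<notin> path_edges (whole_edges X)"
proof -
  obtain l where l: "l < i - j" "edge_of G (d, j + l) \<notin> X" "edge_of G (d, j + Suc l) \<in> X"
    using ex_least_nat_less[of "\<lambda>l. edge_of G (d, j + l) \<in> X" "i - j"] assms by auto
  define k where "k = j + l"
  have k: "k < i" "edge_of G (d, k) \<notin> X" "edge_of G (d, Suc k) \<in> X"
    using l by (auto simp: k_def)
  then have "edge_of G (d, k) \<notin> path_edges (whole_edges X)"
    using path_edges_whole_edges by blast
  then have "edge_of G (d, Suc k) \<notin> path_edges (whole_edges X)"
    using k(1) \<open>i \<le> m\<close> d
    by (simp add: edge_of_in_path_edges_iff[OF whole_edges_subset] del: Union_iff)
  moreover have "G.pendant X (d, Suc k)"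
    using X d k \<open>i \<le> m\<close> by (intro pendant_along_path) auto
  ultimately show ?thesis by blast
qed

lemma exists_pendant_edge:
  assumes X: "X \<subseteq> edges G" and x: "x \<in> X" "x \<notin> path_edges (whole_edges X)"
  shows "\<exists>z. G.pendant X z \<and> edge_of G z \<notin> path_edges (whole_edges X)"
proof -
  have "x \<in> edge_of G ` (darts F \<times> {..m})"
    using X x(1) by (auto simp: edges_eq_image[of G])
  then obtain d i where d: "d \<in> darts F" "i \<le> m" "x = edge_of G (d, i)" by auto
  then have "x \<in> path_edges {edge_of F d}"
    by (simp add: path_edges_edge_of)
  then have "edge_of F d \<notin> whole_edges X"
    using x(2) path_edges_mono[of "{edge_of F d}" "whole_edges X"] by auto
  then obtain j where j: "j \<le> m" "edge_of G (d, j) \<notin> X"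
    using d(1) by (auto simp: whole_edges_def path_edges_edge_of edges_eq_image[of F])
  have "j \<noteq> i"
    using j(2) d(3) x(1) by auto
  then consider "j < i" | "m - j < m - i"
    using j(1) by linarith
  then show ?thesis
  proof cases
    case 1
    then show ?thesis
      using exists_pendant_edge_along_path[OF X d(1)] j d x(1) by simp
  next
    case 2
    then show ?thesis
      using exists_pendant_edge_along_path[OF X opp_in_darts[OF d(1)], of "m - j" "m - i"]
        edge_of_tensor_opp[OF d(1)] j d x(1) by simp
  qed
qed

lemma remove_partial_paths:
  fixes \<phi> :: "('d \<times> nat) set set \<Rightarrow> int"
  assumes remove: "\<And>X z. X \<subseteq> edges G \<Longrightarrow> G.pendant X z \<Longrightarrow> \<phi> (X - {edge_of G z}) = \<phi> X + 1"
    and "X \<subseteq> edges G"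
  shows "\<phi> X + int (card X) =
    \<phi> (path_edges (whole_edges X)) + int (card (path_edges (whole_edges X)))"
  using assms(2)
proof (induction "card X" arbitrary: X rule: less_induct)
  case less
  show ?case
  proof (cases "X = path_edges (whole_edges X)")
    case False
    then obtain z where pendant: "G.pendant X z"
        and z: "edge_of G z \<notin> path_edges (whole_edges X)"
      using exists_pendant_edge[OF less.prems] path_edges_whole_edges[of X] by blast
    have "edge_of G z \<in> X" "finite X"
      using G.pendant_in_darts(3)[OF less.prems pendant] finite_subset[OF less.prems G.finite_edges]
      by simp_all
    then have "card X = Suc (card (X - {edge_of G z}))"
      by (rule card.remove[rotated])
    moreover have "X - {edge_of G z} \<subseteq> edges G"
      using less.prems by blast
    ultimately show ?thesis
      using less.hyps[of "X - {edge_of G z}"] whole_edges_remove[OF z] remove[OF less.prems pendant]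
      by simp
  qed simp
qed

lemma int_card_Diff_edges: "A \<subseteq> edges F \<Longrightarrow> int (card (edges F - A)) = num_e F - int (card A)"
  by (simp add: num_e_def card_Diff_subset finite_subset[OF _ finite_edges] finite_edges card_mono
      of_nat_diff)

lemma num_k_tensor_state:
  assumes "X \<subseteq> edges G"
  shows "num_k (spanning_sub G X) =
    num_k (spanning_sub F (whole_edges X)) + int m * num_e F
      + int (card (whole_edges X)) - int (card X)"
  using remove_partial_paths[OF G.num_k_remove_pendant assms]
    num_k_path_edges[OF whole_edges_subset, of X]
  by (simp add: card_path_edges int_card_Diff_edges whole_edges_subset algebra_simps)

lemma num_p_tensor_state:
  assumes "X \<subseteq> edges G"
  shows "num_p (spanning_sub G X) =
    num_p (spanning_sub F (whole_edges X)) + int m * num_e F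
      + int (card (whole_edges X)) - int (card X)"
  using remove_partial_paths[OF G.num_p_remove_pendant assms]
    num_p_path_edges[OF whole_edges_subset, of X]
  by (simp add: card_path_edges int_card_Diff_edges whole_edges_subset algebra_simps)

lemma rk_tensor_state:
  assumes "X \<subseteq> edges G"
  shows "rk (spanning_sub G X) =
    rk (spanning_sub F (whole_edges X)) + int (card X) - int (card (whole_edges X))"
  using num_k_tensor_state[OF assms] by (simp add: rk_def num_v_tensor)

lemma rk_tensor: "rk G = rk F + int m * num_e F"
  using rk_tensor_state[OF subset_refl]
  unfolding whole_edges_edges_tensor G.rk_spanning_sub_edges rk_spanning_sub_edges
  by (simp add: edges_tensor card_path_edges num_e_def)

subsection \<open>The state sum\<close>

definition deficiency :: "('d \<times> nat) set set \<Rightarrow> 'd set \<Rightarrow> nat" where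
  "deficiency X e = (if e \<in> whole_edges X then 0 else m - card (X \<inter> path_edges {e}))"

lemma card_eq_sum_card_Int_path_edges:
  assumes X: "X \<subseteq> edges G"
  shows "card X = (\<Sum>e\<in>edges F. card (X \<inter> path_edges {e}))"
proof -
  have "finite X"
    using X G.finite_edges by (rule finite_subset)
  have "X = (\<Union>e\<in>edges F. X \<inter> path_edges {e})"
    using X unfolding edges_tensor path_edges_UN[of "edges F"] by blast
  then have "card X = card (\<Union>e\<in>edges F. X \<inter> path_edges {e})" by simp
  also have "\<dots> = (\<Sum>e\<in>edges F. card (X \<inter> path_edges {e}))"
    using finite_edges \<open>finite X\<close> disjoint_family_path_edges
    by (intro card_UN_disjoint) (auto simp: disjoint_family_on_def)
  finally show ?thesis .
qed

lemma int_deficiency: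
  assumes e: "e \<in> edges F"
  shows "int (deficiency X e) =
    int m - int (card (X \<inter> path_edges {e})) + of_bool (e \<in> whole_edges X)"
proof (cases "e \<in> whole_edges X")
  case True
  then have "X \<inter> path_edges {e} = path_edges {e}"
    by (auto simp: whole_edges_def)
  with True show ?thesis
    by (simp add: deficiency_def card_path_edges_singleton[OF e])
next
  case False
  then have "X \<inter> path_edges {e} \<subset> path_edges {e}"
    using e by (auto simp: whole_edges_def)
  then have "card (X \<inter> path_edges {e}) < Suc m"
    using psubset_card_mono[of "path_edges {e}"] card_path_edges_singleton[OF e]
    by (metis card_ge_0_finite zero_less_Suc)
  with False show ?thesis
    by (simp add: deficiency_def of_nat_diff)
qed

lemma sum_deficiency:
  assumes X: "X \<subseteq> edges G"
  shows "int (\<Sum>e\<in>edges F. deficiency X e) = rk G - rk (spanning_sub G X) -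
    (rk F - rk (spanning_sub F (whole_edges X)))"
proof -
  have "(\<Sum>e\<in>edges F. of_bool (e \<in> whole_edges X)) = int (card (whole_edges X))"
    using whole_edges_subset[of X] by (simp add: finite_edges Int_absorb1)
  then have "int (\<Sum>e\<in>edges F. deficiency X e) =
      int m * num_e F - int (card X) + int (card (whole_edges X))"
    by (simp add: int_deficiency sum.distrib sum_subtractf card_eq_sum_card_Int_path_edges[OF X]
        num_e_def)
  then show ?thesis
    by (simp add: rk_tensor rk_tensor_state[OF X])
qed

lemma state_term_tensor:
  fixes a b c :: "'a::field"
  assumes X: "X \<subseteq> edges G" and "a \<noteq> 0"
  shows "state_term G a b c X =
    (\<Prod>e\<in>edges F. a ^ deficiency X e) * state_term F a b c (whole_edges X)"
proof -
  let ?H = "spanning_sub G X" and ?K = "spanning_sub F (whole_edges X)"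
  have "rk G - rk ?H = int (\<Sum>e\<in>edges F. deficiency X e) + (rk F - rk ?K)"
    using sum_deficiency[OF X] by linarith
  moreover have "nul ?H = nul ?K"
    unfolding nul_def rk_tensor_state[OF X]
    by (simp add: num_e_spanning_sub G.num_e_spanning_sub[OF X] whole_edges_subset)
  moreover have "num_k ?H - num_p ?H = num_k ?K - num_p ?K"
    by (simp add: num_k_tensor_state[OF X] num_p_tensor_state[OF X])
  ultimately show ?thesis
    using \<open>a \<noteq> 0\<close> by (simp add: state_term_def Let_def power_int_add power_sum del: of_nat_sum)
qed

lemma sum_deficiency_power:
  fixes a :: "'a::field"
  assumes A: "A \<subseteq> edges F" and "a \<noteq> 0"
  shows "(\<Sum>X | X \<in> Pow (edges G) \<and> whole_edges X = A. \<Prod>e\<in>edges F. a ^ deficiency X e)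
    = (\<Sum>i\<le>m. (1 + a) ^ i) ^ card (edges F - A)"
proof -
  define \<Y> where "\<Y> e = (if e \<in> A then {path_edges {e}} else {Y. Y \<subset> path_edges {e}})" for e
  define g where "g e Y = (if e \<in> A then 1 else a ^ (m - card Y))"
    for e and Y :: "('d \<times> nat) set set"
  have "X \<inter> path_edges {e} \<in> \<Y> e \<longleftrightarrow> (e \<in> A \<longleftrightarrow> path_edges {e} \<subseteq> X)" for X e
    by (auto simp: \<Y>_def)
  moreover have "whole_edges X = A \<longleftrightarrow> (\<forall>e\<in>edges F. e \<in> A \<longleftrightarrow> path_edges {e} \<subseteq> X)" for X
    using A by (auto simp: whole_edges_def)
  ultimately have fibre: "{X. X \<in> Pow (edges G) \<and> whole_edges X = A} =
      {X. X \<subseteq> (\<Union>e\<in>edges F. path_edges {e}) \<and> (\<forall>e\<in>edges F. X \<inter> path_edges {e} \<in> \<Y> e)}"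
    by (simp add: edges_tensor flip: path_edges_UN)
  have "(\<Sum>X | X \<in> Pow (edges G) \<and> whole_edges X = A. \<Prod>e\<in>edges F. a ^ deficiency X e)
      = (\<Sum>X | X \<in> Pow (edges G) \<and> whole_edges X = A. \<Prod>e\<in>edges F. g e (X \<inter> path_edges {e}))"
    by (intro sum.cong prod.cong refl) (auto simp: g_def deficiency_def)
  also have "\<dots> = (\<Prod>e\<in>edges F. \<Sum>Y\<in>\<Y> e. g e Y)"
    unfolding fibre using finite_edges disjoint_family_path_edges
  proof (rule sum_prod_Int_disjoint_family)
    show "finite (path_edges {e})" if "e \<in> edges F" for e
      using card_path_edges_singleton[OF that] by (simp add: card_ge_0_finite)
  qed (auto simp: \<Y>_def)
  also have "\<dots> = (\<Prod>e\<in>edges F. if e \<in> A then 1 else \<Sum>i\<le>m. (1 + a) ^ i)"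
    using sum_psubset_power[OF card_path_edges_singleton \<open>a \<noteq> 0\<close>]
    by (intro prod.cong) (auto simp: \<Y>_def g_def)
  also have "\<dots> = (\<Sum>i\<le>m. (1 + a) ^ i) ^ card (edges F - A)"
    by (simp add: prod.If_cases finite_edges Diff_eq)
  finally show ?thesis .
qed

lemma power_card_Diff_edges_state_term:
  fixes a b c \<sigma> :: "'a::field"
  assumes "A \<subseteq> edges F" and "\<sigma> \<noteq> 0"
  shows "\<sigma> ^ card (edges F - A) * state_term F a b c A =
    \<sigma> powi nul F * state_term F (a * \<sigma>) (b / \<sigma>) c A"
proof -
  let ?H = "spanning_sub F A"
  have "int (card (edges F - A)) = nul F + (rk F - rk ?H) - nul ?H"
    using assms(1) by (simp add: int_card_Diff_edges nul_def num_e_spanning_sub)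
  then have "\<sigma> ^ card (edges F - A) = \<sigma> powi nul F * \<sigma> powi (rk F - rk ?H) / \<sigma> powi nul ?H"
    using \<open>\<sigma> \<noteq> 0\<close> by (simp add: power_int_add power_int_diff flip: power_int_of_nat)
  then show ?thesis
    by (simp add: state_term_def Let_def power_int_mult_distrib power_int_divide_distrib)
qed

lemma BR_poly_tensor:
  fixes a b c :: "'a::field"
  assumes "a \<noteq> 0" and \<sigma>: "\<sigma> = (\<Sum>i\<le>m. (1 + a) ^ i)" "\<sigma> \<noteq> 0"
  shows "BR_poly G a b c = \<sigma> powi nul F * BR_poly F (a * \<sigma>) (b / \<sigma>) c"
proof -
  have "BR_poly G a b c = (\<Sum>X\<in>Pow (edges G).
      (\<Prod>e\<in>edges F. a ^ deficiency X e) * state_term F a b c (whole_edges X))"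
    unfolding G.BR_poly_eq_sum_state_term
    using \<open>a \<noteq> 0\<close> by (intro sum.cong refl state_term_tensor) auto
  also have "\<dots> = (\<Sum>A\<in>Pow (edges F). \<Sum>X | X \<in> Pow (edges G) \<and> whole_edges X = A.
      (\<Prod>e\<in>edges F. a ^ deficiency X e) * state_term F a b c (whole_edges X))"
    using G.finite_edges finite_edges whole_edges_subset by (intro sum.group[symmetric]) auto
  also have "\<dots> = (\<Sum>A\<in>Pow (edges F). \<sigma> ^ card (edges F - A) * state_term F a b c A)"
    using \<open>a \<noteq> 0\<close>
    by (intro sum.cong refl) (simp add: \<sigma>(1) sum_distrib_right flip: sum_deficiency_power)
  also have "\<dots> = (\<Sum>A\<in>Pow (edges F). \<sigma> powi nul F * state_term F (a * \<sigma>) (b / \<sigma>) c A)"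
    using \<sigma>(2) by (intro sum.cong refl power_card_Diff_edges_state_term) auto
  also have "\<dots> = \<sigma> powi nul F * BR_poly F (a * \<sigma>) (b / \<sigma>) c"
    by (simp add: BR_poly_eq_sum_state_term sum_distrib_left)
  finally show ?thesis .
qed

end

theorem BR_poly_tensor_cycle:
  fixes F :: "('v, 'd) pre_ribbon_graph" and a b c :: "'a::field"
  assumes "ribbon_graph F" and "2 \<le> p" and "a \<noteq> 0"
    and "\<sigma> = (\<Sum>i<p - 1. (1 + a) ^ i)" and "\<sigma> \<noteq> 0"
  shows "BR_poly (tensor_cycle F p) a b c = \<sigma> powi nul F * BR_poly F (a * \<sigma>) (b / \<sigma>) c"
proof -
  interpret cycle_tensor F "p - 2"
    using assms(1) by (rule cycle_tensor.intro)
  have "Suc (Suc (p - 2)) = p" "{..p - 2} = {..<p - 1}"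
    using assms(2) by auto
  then show ?thesis
    using BR_poly_tensor[of a \<sigma> b c] assms by simp
qed

theorem theorem5p2:
  fixes F :: "('v, 'd) pre_ribbon_graph" and \<alpha> \<beta> \<gamma> s :: complex
  assumes "ribbon_graph F"
    and "\<alpha> \<noteq> - 2" and "\<alpha> \<noteq> 0" and "\<alpha> \<noteq> 1"
    and "\<beta> = \<alpha> * (1 - \<alpha>)"
    and "s\<^sup>2 = \<alpha> * \<beta>" and "\<gamma> = 1 / s"
  shows "BR_poly (tensor_cycle F 3) \<alpha> \<beta> \<gamma>
         = (\<alpha> + 2) powi nul F * BR_poly F (\<alpha> * (\<alpha> + 2)) (\<beta> / (\<alpha> + 2)) \<gamma>"
proof -
  have "\<alpha> + 2 \<noteq> 0"
    using \<open>\<alpha> \<noteq> - 2\<close> by (simp add: add_eq_0_iff2)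
  moreover have "\<alpha> + 2 = (\<Sum>i<3 - 1. (1 + \<alpha>) ^ i)"
    by (simp add: numeral_2_eq_2)
  ultimately show ?thesis
    using \<open>ribbon_graph F\<close> \<open>\<alpha> \<noteq> 0\<close> by (intro BR_poly_tensor_cycle) auto
qed

end
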